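(* Let $\Omega\subseteq\mathbb{C}$ be a connected open set, $n\ge 2$, and let $T,\tilde T\in\tilde{\mathcal{F}}B_n(\Omega)$, with diagonal entries $T_i,\tilde T_i$ ($0\le i\le n-1$) and superdiagonal entries $S_{i,i+1},\tilde S_{i,i+1}$ ($0\le i\le n-2$). Let $t_{n-1}$ and $\tilde t_{n-1}$ be non-vanishing holomorphic sections over $\Omega$ of the line bundles $E_{T_{n-1}}$ and $E_{\tilde T_{n-1}}$ respectively, and define recursively $t_{i-1}=S_{i-1,i}(t_i)$ and $\tilde t_{i-1}=\tilde S_{i-1,i}(\tilde t_i)$ for $1\le i\le n-1$. Then $T$ and $\tilde T$ are unitarily equivalent if and only if (i) $\mathcal{K}_{T_{n-1}}=\mathcal{K}_{\tilde T_{n-1}}$ on $\Omega$, and (ii) $\dfrac{\|t_{i-1}\|}{\|t_i\|}=\dfrac{\|\tilde t_{i-1}\|}{\|\tilde t_i\|}$ for $1\le i\le n-1$ (as functions of $w$, at all points of $\Omega$ where the denominators are non-zero).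
   Context: All Hilbert spaces are complex and separable and all operators are bounded and linear. For a connected open set $\Omega\subseteq\mathbb{C}$ and a positive integer $n$, $B_n(\Omega)$ (the Cowen-Douglas class) is the set of bounded operators $T$ on a Hilbert space $\mathcal{H}$ such that $\Omega\subset\sigma(T)$; $\mathrm{ran}(T-w)=\mathcal{H}$ for all $w\in\Omega$; the closed linear span of $\bigcup_{w\in\Omega}\ker(T-w)$ is $\mathcal{H}$; and $\dim\ker(T-w)=n$ for all $w\in\Omega$. For $T\in B_n(\Omega)$, $E_T=\{(w,x)\in\Omega\times\mathcal{H}: x\in\ker(T-w)\}$ is the associated rank $n$ holomorphic Hermitian vector bundle over $\Omega$; a holomorphic section of it is a holomorphic map $\gamma:\Omega\to\mathcal{H}$ with $\gamma(w)\in\ker(T-w)$. For $T\in B_1(\Omega)$ the curvature is $\mathcal{K}_T(w)=-\frac{\partial^2}{\partial w\partial\bar w}\log\|\gamma(w)\|^2$, where $\gamma$ is any non-vanishing holomorphic section of $E_T$ (the value does not depend on $\gamma$). $\tilde{\mathcal{F}}B_n(\Omega)$ is the set of bounded operators $T$ on an orthogonal direct sum $\mathcal{H}_0\oplus\cdots\oplus\mathcal{H}_{n-1}$ whose block matrix has diagonal entries $T_i:\mathcal{H}_i\to\mathcal{H}_i$ in $B_1(\Omega)$ ($0\le i\le n-1$), entries $S_{i,i+1}:\mathcal{H}_{i+1}\to\mathcal{H}_i$ on the first superdiagonal ($0\le i\le n-2$), and all other entries zero, where each $S_{i,i+1}$ is non-zero and $T_iS_{i,i+1}=S_{i,i+1}T_{i+1}$.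 *)

theory Defs
  imports "HOL-Analysis.Analysis"
begin

section \<open>Separable complex Hilbert spaces\<close>

text \<open>The inner product is linear in its first argument. Positive definiteness is implied by
  \<open>cinner_self\<close>, as \<open>norm\<close> is already a norm.\<close>

class chilbert_space = banach +
  fixes scaleC :: "complex \<Rightarrow> 'a \<Rightarrow> 'a"  (infixr "*\<^sub>C" 75)
    and cinner :: "'a \<Rightarrow> 'a \<Rightarrow> complex"
  assumes scaleC_add_right: "a *\<^sub>C (x + y) = a *\<^sub>C x + a *\<^sub>C y"
    and scaleC_add_left: "(a + b) *\<^sub>C x = a *\<^sub>C x + b *\<^sub>C x"
    and scaleC_scaleC: "a *\<^sub>C b *\<^sub>C x = (a * b) *\<^sub>C x"
    and scaleC_of_real: "complex_of_real r *\<^sub>C x = r *\<^sub>R x"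
    and cinner_add_left: "cinner (x + y) z = cinner x z + cinner y z"
    and cinner_scaleC_left: "cinner (a *\<^sub>C x) y = a * cinner x y"
    and cinner_commute: "cinner y x = cnj (cinner x y)"
    and cinner_self: "cinner x x = complex_of_real ((norm x)\<^sup>2)"
    and separable: "\<exists>D. countable D \<and> (\<forall>x. \<forall>e>0. \<exists>d\<in>D. dist d x < e)"

global_interpretation complex_vector:
  vector_space "scaleC :: complex \<Rightarrow> 'a::chilbert_space \<Rightarrow> 'a"
  defines csubspace = complex_vector.subspace
    and cspan = complex_vector.span
    and cdim = complex_vector.dim
proof
  show "1 *\<^sub>C x = x" for x :: 'a
    using scaleC_of_real[of 1 x] by simp
qed (simp_all add: scaleC_add_right scaleC_add_left scaleC_scaleC)

definition closed_csubspace :: "'a::chilbert_space set \<Rightarrow> bool" where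
  "closed_csubspace M \<longleftrightarrow> csubspace M \<and> closed M"

text \<open>The summands of an orthogonal direct sum with a variable number of terms cannot be separate
  types. They are closed subspaces of the sum, and an operator between closed subspaces \<open>M\<close> and \<open>N\<close>
  is a function of which only the values on \<open>M\<close> matter.\<close>

definition bounded_operator ::
    "'a::chilbert_space set \<Rightarrow> 'b::chilbert_space set \<Rightarrow> ('a \<Rightarrow> 'b) \<Rightarrow> bool" where
  "bounded_operator M N A \<longleftrightarrow>
     A ` M \<subseteq> N \<and>
     (\<forall>x\<in>M. \<forall>y\<in>M. A (x + y) = A x + A y) \<and>
     (\<forall>c. \<forall>x\<in>M. A (c *\<^sub>C x) = c *\<^sub>C A x) \<and>
     (\<exists>K. \<forall>x\<in>M. norm (A x) \<le> K * norm x)"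

definition unitary :: "('a::chilbert_space \<Rightarrow> 'b::chilbert_space) \<Rightarrow> bool" where
  "unitary U \<longleftrightarrow> bounded_operator UNIV UNIV U \<and> surj U \<and> (\<forall>x y. cinner (U x) (U y) = cinner x y)"

definition unitarily_equivalent ::
    "('a::chilbert_space \<Rightarrow> 'a) \<Rightarrow> ('b::chilbert_space \<Rightarrow> 'b) \<Rightarrow> bool" where
  "unitarily_equivalent T T' \<longleftrightarrow> (\<exists>U :: 'a \<Rightarrow> 'b. unitary U \<and> (\<forall>x. U (T x) = T' (U x)))"

section \<open>The Cowen--Douglas class and curvature\<close>

definition spectrum :: "'a::chilbert_space set \<Rightarrow> ('a \<Rightarrow> 'a) \<Rightarrow> complex set" where
  "spectrum M T = {w. \<not> (\<exists>R. bounded_operator M M R \<and>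
     (\<forall>x\<in>M. R (T x - w *\<^sub>C x) = x) \<and> (\<forall>x\<in>M. T (R x) - w *\<^sub>C R x = x))}"

definition eigenspace :: "'a::chilbert_space set \<Rightarrow> ('a \<Rightarrow> 'a) \<Rightarrow> complex \<Rightarrow> 'a set" where
  "eigenspace M T w = {x \<in> M. T x - w *\<^sub>C x = 0}"

text \<open>\<open>T\<close> is an operator on \<open>M\<close> belonging to $B_n(\Omega)$. As \<open>cdim\<close> is \<open>0\<close> for infinite-dimensional
  spaces, the last condition includes finite-dimensionality.\<close>

definition cowen_douglas ::
    "nat \<Rightarrow> complex set \<Rightarrow> 'a::chilbert_space set \<Rightarrow> ('a \<Rightarrow> 'a) \<Rightarrow> bool" where
  "cowen_douglas n \<Omega> M T \<longleftrightarrow>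
     0 < n \<and>
     closed_csubspace M \<and>
     bounded_operator M M T \<and>
     \<Omega> \<subseteq> spectrum M T \<and>
     (\<forall>w\<in>\<Omega>. (\<lambda>x. T x - w *\<^sub>C x) ` M = M) \<and>
     closure (cspan (\<Union>w\<in>\<Omega>. eigenspace M T w)) = M \<and>
     (\<forall>w\<in>\<Omega>. cdim (eigenspace M T w) = n)"

definition holomorphic_section ::
    "complex set \<Rightarrow> 'a::chilbert_space set \<Rightarrow> ('a \<Rightarrow> 'a) \<Rightarrow> (complex \<Rightarrow> 'a) \<Rightarrow> bool" where
  "holomorphic_section \<Omega> M T \<gamma> \<longleftrightarrow>
     (\<forall>w\<in>\<Omega>. \<exists>d. (\<gamma> has_derivative (\<lambda>h. h *\<^sub>C d)) (at w)) \<and>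
     (\<forall>w\<in>\<Omega>. \<gamma> w \<in> eigenspace M T w)"

definition nonvanishing_section ::
    "complex set \<Rightarrow> 'a::chilbert_space set \<Rightarrow> ('a \<Rightarrow> 'a) \<Rightarrow> (complex \<Rightarrow> 'a) \<Rightarrow> bool" where
  "nonvanishing_section \<Omega> M T \<gamma> \<longleftrightarrow> holomorphic_section \<Omega> M T \<gamma> \<and> (\<forall>w\<in>\<Omega>. \<gamma> w \<noteq> 0)"

definition partial_x :: "(complex \<Rightarrow> complex) \<Rightarrow> complex \<Rightarrow> complex" where
  "partial_x f w = vector_derivative (\<lambda>s. f (w + complex_of_real s)) (at 0)"

definition partial_y :: "(complex \<Rightarrow> complex) \<Rightarrow> complex \<Rightarrow> complex" where
  "partial_y f w = vector_derivative (\<lambda>s. f (w + \<i> * complex_of_real s)) (at 0)"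

definition d_w :: "(complex \<Rightarrow> complex) \<Rightarrow> complex \<Rightarrow> complex" where
  "d_w f w = (partial_x f w - \<i> * partial_y f w) / 2"

definition d_wbar :: "(complex \<Rightarrow> complex) \<Rightarrow> complex \<Rightarrow> complex" where
  "d_wbar f w = (partial_x f w + \<i> * partial_y f w) / 2"

text \<open>For \<open>T\<close> in $B_1(\Omega)$ the value of the curvature does not depend on the section.\<close>

definition curvature ::
    "complex set \<Rightarrow> 'a::chilbert_space set \<Rightarrow> ('a \<Rightarrow> 'a) \<Rightarrow> complex \<Rightarrow> complex" where
  "curvature \<Omega> M T w =
     (let \<gamma> = (SOME \<gamma>. nonvanishing_section \<Omega> M T \<gamma>)
      in - d_w (d_wbar (\<lambda>z. complex_of_real (ln ((norm (\<gamma> z))\<^sup>2)))) w)"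

section \<open>Block operators\<close>

definition orthogonal_direct_sum :: "nat \<Rightarrow> (nat \<Rightarrow> 'a::chilbert_space set) \<Rightarrow> bool" where
  "orthogonal_direct_sum n H \<longleftrightarrow>
     (\<forall>i<n. closed_csubspace (H i)) \<and>
     (\<forall>i<n. \<forall>j<n. i \<noteq> j \<longrightarrow> (\<forall>x\<in>H i. \<forall>y\<in>H j. cinner x y = 0)) \<and>
     (\<forall>x. \<exists>h. (\<forall>i<n. h i \<in> H i) \<and> x = (\<Sum>i<n. h i))"

definition has_block_matrix :: "nat \<Rightarrow> (nat \<Rightarrow> 'a::chilbert_space set) \<Rightarrow>
    ('a \<Rightarrow> 'a) \<Rightarrow> (nat \<Rightarrow> nat \<Rightarrow> 'a \<Rightarrow> 'a) \<Rightarrow> bool" where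
  "has_block_matrix n H T A \<longleftrightarrow>
     (\<forall>i<n. \<forall>j<n. bounded_operator (H j) (H i) (A i j)) \<and>
     (\<forall>j<n. \<forall>x\<in>H j. T x = (\<Sum>i<n. A i j x))"

text \<open>\<open>T\<close> is an operator in $\tilde{\mathcal F}B_n(\Omega)$ on the orthogonal direct sum of
  \<open>H 0, \<dots>, H (n - 1)\<close>. The diagonal entries of its block matrix are \<open>A i i\<close> (written $T_i$), the
  superdiagonal ones \<open>A i (i + 1)\<close> (written $S_{i,i+1}$).\<close>

definition FB_tilde :: "nat \<Rightarrow> complex set \<Rightarrow> (nat \<Rightarrow> 'a::chilbert_space set) \<Rightarrow>
    ('a \<Rightarrow> 'a) \<Rightarrow> (nat \<Rightarrow> nat \<Rightarrow> 'a \<Rightarrow> 'a) \<Rightarrow> bool" where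
  "FB_tilde n \<Omega> H T A \<longleftrightarrow>
     orthogonal_direct_sum n H \<and>
     bounded_operator UNIV UNIV T \<and>
     has_block_matrix n H T A \<and>
     (\<forall>i<n. cowen_douglas 1 \<Omega> (H i) (A i i)) \<and>
     (\<forall>i<n. \<forall>j<n. j \<noteq> i \<and> j \<noteq> i + 1 \<longrightarrow> (\<forall>x\<in>H j. A i j x = 0)) \<and>
     (\<forall>i. i + 1 < n \<longrightarrow>
        (\<exists>x\<in>H (i + 1). A i (i + 1) x \<noteq> 0) \<and>
        (\<forall>x\<in>H (i + 1). A i i (A i (i + 1) x) = A i (i + 1) (A (i + 1) (i + 1) x)))"

end

(* The curvature of B_1 operators determines ||t_{n-1}|| up to the modulus of a holomorphic function phi
   on a disc, and the ratios propagate ||t_i|| = |phi| ||t'_i|| down to all i. By polarisation the Gram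
   matrices of the families t_i(w) and phi(w) t'_i(w), w in the disc, agree; both families are total,
   so a unitary maps one to the other, and it intertwines T and T' because
   T t_i(w) = w t_i(w) + t_{i-1}(w).

   Conversely, write T = D + S with D diagonal and S superdiagonal. For the grading operator G,
   multiplication by i on H_i, one has [T,G] = S and [T,S] = 0, so that every Z commuting with T
   satisfies [T,ZG] = ZS and [T,ZS] = 0. As in the Kleinecke--Shirokov theorem, ZS has no non-zero
   eigenvalue on ker(T - w). If a unitary U intertwines T and T' without matching the flags
   F_j = H_0 + ... + H_{j-1}, a product of powers of S and of the pull-back of S' has such an
   eigenvalue. So U preserves the flags, hence the summands H_j, and is block diagonal. *)

theory Submission
  imports Defs "HOL-Complex_Analysis.Complex_Analysis"
begin

section \<open>Hilbert space geometry\<close>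

text \<open>A unitary intertwiner is not known in advance to respect the blocks: \<open>S\<close>
  itself commutes with \<open>T\<close> and mixes the summands, and eigenvectors of \<open>T\<close>
  are not homogeneous for the grading. Eigenvectors are therefore compared only modulo a member
  \<open>F j\<close> of the flag, where an eigenvector over \<open>t j w\<close> looks like
  \<open>t j w\<close>. A round trip through the other space (apply \<open>U\<close>, lower by S',
  return, lower by S) reproduces such an eigenvector up to a non-zero factor modulo
  \<open>F j\<close>. If S' really occurs, the round trip is a commutator with \<open>T\<close>, and
  its k-th power on an eigenvector of \<open>T\<close> has size at most const^k / k!. This excludes
  a non-zero eigenvalue even modulo a closed invariant subspace. Lowering requires
  \<open>t 0 w\<close> and \<open>t' 0 w\<close> to be non-zero, so the argument runs on a smaller
  open set; in the other direction the holomorphic factor is built only on a disc, as \<Omega> may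
  fail to be simply connected. Both restrictions are harmless: the values of \<open>t i\<close> on
  any non-empty open subset of \<Omega> span a dense subspace of \<open>H i\<close>.\<close>

lemma cinner_add_right: "cinner x (y + z) = cinner x y + cinner x z"
  for x :: "'a::chilbert_space"
  by (metis cinner_add_left cinner_commute complex_cnj_add)

lemma cinner_scaleC_right: "cinner x (a *\<^sub>C y) = cnj a * cinner x y"
  for x :: "'a::chilbert_space"
  by (metis cinner_scaleC_left cinner_commute complex_cnj_mult)

lemma scaleR_eq_scaleC: "r *\<^sub>R x = complex_of_real r *\<^sub>C x"
  for x :: "'a::chilbert_space"
  by (simp add: scaleC_of_real)

lemma cinner_zero_left [simp]: "cinner 0 x = 0" and cinner_zero_right [simp]: "cinner x 0 = 0"
  for x :: "'a::chilbert_space"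
  using cinner_add_left[of 0 0 x] cinner_add_right[of x 0 0] by simp_all

lemma cinner_minus_left: "cinner (- x) y = - cinner x y"
  for x :: "'a::chilbert_space"
  using cinner_add_left[of x "- x" y] by (simp add: eq_neg_iff_add_eq_0 add.commute)

lemma cinner_minus_right: "cinner x (- y) = - cinner x y"
  for x :: "'a::chilbert_space"
  using cinner_add_right[of x y "- y"] by (simp add: eq_neg_iff_add_eq_0 add.commute)

lemma cinner_diff_left: "cinner (x - y) z = cinner x z - cinner y z"
  for x :: "'a::chilbert_space"
  using cinner_add_left[of x "- y" z] by (simp add: cinner_minus_left)

lemma cinner_sum_left: "cinner (\<Sum>i\<in>I. f i) x = (\<Sum>i\<in>I. cinner (f i) x)"
  for x :: "'a::chilbert_space"
  by (induction I rule: infinite_finite_induct) (simp_all add: cinner_add_left)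

lemma cinner_eq_zero_iff [simp]: "cinner x x = 0 \<longleftrightarrow> x = 0"
  for x :: "'a::chilbert_space"
  by (simp add: cinner_self)

lemma cinner_eq_zero_commute: "cinner x y = 0 \<longleftrightarrow> cinner y x = 0"
  for x :: "'a::chilbert_space"
  by (metis cinner_commute complex_cnj_zero)

lemma norm_scaleC [simp]: "norm (a *\<^sub>C x) = cmod a * norm x"
  for x :: "'a::chilbert_space"
proof -
  have "complex_of_real ((norm (a *\<^sub>C x))\<^sup>2) = (a * cnj a) * cinner x x"
    unfolding cinner_self[symmetric] cinner_scaleC_left cinner_scaleC_right
    by (simp only: ac_simps)
  also have "\<dots> = complex_of_real ((cmod a * norm x)\<^sup>2)"
    unfolding cinner_self complex_norm_square[symmetric] of_real_mult[symmetric] power_mult_distrib ..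
  finally have "complex_of_real ((norm (a *\<^sub>C x))\<^sup>2) = complex_of_real ((cmod a * norm x)\<^sup>2)" .
  then show ?thesis
    by (simp only: of_real_eq_iff) (simp add: power2_eq_iff_nonneg)
qed

lemma scaleC_zero_iff [simp]: "a *\<^sub>C x = 0 \<longleftrightarrow> a = 0 \<or> x = 0"
  for x :: "'a::chilbert_space"
  by (metis norm_scaleC mult_eq_0_iff norm_eq_zero)

lemma norm_add_square: "(norm (x + y))\<^sup>2 = (norm x)\<^sup>2 + (norm y)\<^sup>2 + 2 * Re (cinner x y)"
  for x :: "'a::chilbert_space"
proof -
  have "complex_of_real ((norm (x + y))\<^sup>2) =
      complex_of_real ((norm x)\<^sup>2) + complex_of_real ((norm y)\<^sup>2) + (cinner x y + cnj (cinner x y))"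
    by (simp only: cinner_self[symmetric] cinner_add_left cinner_add_right cinner_commute[of x y])
       (simp add: algebra_simps)
  then have "Re (complex_of_real ((norm (x + y))\<^sup>2)) =
      Re (complex_of_real ((norm x)\<^sup>2) + complex_of_real ((norm y)\<^sup>2) + (cinner x y + cnj (cinner x y)))"
    by simp
  then show ?thesis
    by (simp del: of_real_power)
qed

lemma norm_diff_square: "(norm (x - y))\<^sup>2 = (norm x)\<^sup>2 + (norm y)\<^sup>2 - 2 * Re (cinner x y)"
  for x :: "'a::chilbert_space"
  using norm_add_square[of x "- y"] by (simp add: cinner_minus_right)

lemma Cauchy_Schwarz_cinner: "cmod (cinner x y) \<le> norm x * norm y"
  for x :: "'a::chilbert_space"
proof (cases "y = 0")
  case False
  \<comment> \<open>The vector \<open>c *\<^sub>C y\<close> is the orthogonal projection of x onto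
    the line through y.\<close>
  define c where "c = cinner x y / complex_of_real ((norm y)\<^sup>2)"
  have "(norm (x - c *\<^sub>C y))\<^sup>2 = (norm x)\<^sup>2 - (cmod (cinner x y))\<^sup>2 / (norm y)\<^sup>2"
  proof -
    have "cinner x (c *\<^sub>C y) = complex_of_real ((cmod (cinner x y))\<^sup>2 / (norm y)\<^sup>2)"
      using complex_norm_square[of "cinner x y"] by (simp add: c_def cinner_scaleC_right mult.commute)
    moreover have "(norm (c *\<^sub>C y))\<^sup>2 = (cmod (cinner x y))\<^sup>2 / (norm y)\<^sup>2"
      using False by (simp add: c_def norm_divide power_mult_distrib power_divide field_simps power2_eq_square norm_mult)
    ultimately show ?thesis
      by (simp add: norm_diff_square del: of_real_divide of_real_power norm_scaleC)
  qed
  then have "(cmod (cinner x y))\<^sup>2 / (norm y)\<^sup>2 \<le> (norm x)\<^sup>2"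
    using zero_le_power2[of "norm (x - c *\<^sub>C y)"] by linarith
  then have "(cmod (cinner x y))\<^sup>2 \<le> (norm x * norm y)\<^sup>2"
    using False by (simp add: divide_le_eq power_mult_distrib)
  then show ?thesis
    by (rule power2_le_imp_le) simp
qed simp

lemma bounded_bilinear_cinner: "bounded_bilinear (cinner :: 'a::chilbert_space \<Rightarrow> 'a \<Rightarrow> complex)"
proof
  show "\<exists>K. \<forall>a b :: 'a. norm (cinner a b) \<le> norm a * norm b * K"
    by (rule exI[of _ 1]) (simp add: Cauchy_Schwarz_cinner)
qed (simp_all add: cinner_add_left cinner_add_right scaleR_eq_scaleC cinner_scaleC_left
  cinner_scaleC_right scaleR_conv_of_real)

lemma bounded_bilinear_scaleC:
  "bounded_bilinear (scaleC :: complex \<Rightarrow> 'a::chilbert_space \<Rightarrow> 'a)"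
proof
  show "\<exists>K. \<forall>a. \<forall>b :: 'a. norm (a *\<^sub>C b) \<le> norm a * norm b * K"
    by (rule exI[of _ 1]) simp
qed (simp_all add: scaleC_add_left scaleC_add_right scaleR_eq_scaleC scaleC_scaleC
  scaleR_conv_of_real mult.commute)

text \<open>This turns scalar estimates on \<open>cinner (f z) x\<close> that are uniform in x into
  norm estimates. The bound is tested at x = y.\<close>

lemma norm_le_if_cinner_le:
  fixes y :: "'a::chilbert_space"
  assumes "\<And>x. cmod (cinner y x) \<le> c * norm x" and "0 \<le> c"
  shows "norm y \<le> c"
proof -
  have "(norm y)\<^sup>2 \<le> c * norm y"
    using assms(1)[of y] by (simp add: cinner_self norm_power)
  then show ?thesis
    using assms(2) by (cases "norm y = 0") (simp_all add: power2_eq_square)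
qed

lemma closed_csubspaceD:
  assumes "closed_csubspace M"
  shows "closed M" and "0 \<in> M" and "\<And>x y. x \<in> M \<Longrightarrow> y \<in> M \<Longrightarrow> x + y \<in> M"
    and "\<And>c x. x \<in> M \<Longrightarrow> c *\<^sub>C x \<in> M" and "\<And>x y. x \<in> M \<Longrightarrow> y \<in> M \<Longrightarrow> x - y \<in> M"
    and "\<And>x. x \<in> M \<Longrightarrow> - x \<in> M"
  using assms
  by (auto simp: closed_csubspace_def complex_vector.subspace_0 complex_vector.subspace_add
      complex_vector.subspace_scale complex_vector.subspace_diff complex_vector.subspace_neg)

lemma closed_csubspaceI:
  assumes "closed M" and "0 \<in> M" and "\<And>x y. x \<in> M \<Longrightarrow> y \<in> M \<Longrightarrow> x + y \<in> M"
    and "\<And>c x. x \<in> M \<Longrightarrow> c *\<^sub>C x \<in> M"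
  shows "closed_csubspace M"
  using assms by (auto simp: closed_csubspace_def complex_vector.subspace_def)

lemma closed_csubspace_Int:
  "closed_csubspace M \<Longrightarrow> closed_csubspace N \<Longrightarrow> closed_csubspace (M \<inter> N)"
  by (auto simp: closed_csubspace_def complex_vector.subspace_inter)

lemma closed_csubspace_orthogonal: "closed_csubspace {x. \<forall>y\<in>Y. cinner x y = 0}"
proof (rule closed_csubspaceI)
  have "{x. \<forall>y\<in>Y. cinner x y = 0} = (\<Inter>y\<in>Y. {x. cinner x y = 0})"
    by auto
  moreover have "closed {x. cinner x y = 0}" for y :: 'a
    by (intro closed_Collect_eq continuous_intros
        bounded_linear.continuous_on[OF bounded_bilinear.bounded_linear_left[OF bounded_bilinear_cinner]])
  ultimately show "closed {x. \<forall>y\<in>Y. cinner x y = 0}"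
    by auto
qed (auto simp: cinner_add_left cinner_scaleC_left)

text \<open>The distance from y to \<open>M\<close> is attained: midpoints of a minimising sequence
  stay in \<open>M\<close>, so by the parallelogram law the sequence is Cauchy.\<close>

theorem closed_csubspace_projection:
  fixes M :: "'a::chilbert_space set"
  assumes M: "closed_csubspace M"
  obtains p where "p \<in> M" and "\<And>x. x \<in> M \<Longrightarrow> cinner (y - p) x = 0"
proof -
  define d where "d = Inf ((\<lambda>x. (norm (y - x))\<^sup>2) ` M)"
  have bdd: "bdd_below ((\<lambda>x. (norm (y - x))\<^sup>2) ` M)"
    by (rule bdd_belowI[of _ 0]) auto
  have ne: "(\<lambda>x. (norm (y - x))\<^sup>2) ` M \<noteq> {}"
    using closed_csubspaceD(2)[OF M] by auto
  have d_le: "d \<le> (norm (y - x))\<^sup>2" if "x \<in> M" for x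
    unfolding d_def using that bdd by (auto intro: cInf_lower)
  have "\<exists>x\<in>M. (norm (y - x))\<^sup>2 < d + 1 / real (Suc k)" for k
    using cInf_lessD[OF ne, of "d + 1 / real (Suc k)"] by (auto simp: d_def)
  then obtain s where s: "\<And>k. s k \<in> M" "\<And>k. (norm (y - s k))\<^sup>2 < d + 1 / real (Suc k)"
    by metis
  have par: "(norm (s k - s l))\<^sup>2 \<le> 2 / real (Suc k) + 2 / real (Suc l)" for k l
  proof -
    define m where "m = (1/2) *\<^sub>C (s k + s l)"
    have "m \<in> M"
      unfolding m_def by (intro closed_csubspaceD[OF M] s)
    have "s k - s l = (y - s l) - (y - s k)"
      by simp
    moreover have "(y - s l) + (y - s k) = 2 *\<^sub>R (y - m)"
      using scaleC_of_real[of "1/2" "s k + s l"] by (simp add: m_def algebra_simps scaleR_2)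
    then have "(norm ((y - s l) + (y - s k)))\<^sup>2 = 4 * (norm (y - m))\<^sup>2"
      by (simp add: power_mult_distrib)
    then have "(norm ((y - s l) + (y - s k)))\<^sup>2 \<ge> 4 * d"
      using d_le[OF \<open>m \<in> M\<close>] by simp
    ultimately show ?thesis
      using norm_add_square[of "y - s l" "y - s k"] norm_diff_square[of "y - s l" "y - s k"]
        s(2)[of k] s(2)[of l]
      by (simp del: of_nat_Suc)
  qed
  have "Cauchy s"
  proof (rule metric_CauchyI)
    fix e :: real assume "0 < e"
    then obtain N where N: "1 / real (Suc N) < e\<^sup>2 / 4"
      using nat_approx_posE[of "e\<^sup>2/4"] by auto
    have "dist (s k) (s l) < e" if "N \<le> k" "N \<le> l" for k l
    proof -
      have "1 / real (Suc k) \<le> 1 / real (Suc N)" "1 / real (Suc l) \<le> 1 / real (Suc N)"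
        using that by (auto intro!: divide_left_mono)
      then have "(norm (s k - s l))\<^sup>2 < e\<^sup>2"
        using par[of k l] N by (simp del: of_nat_Suc)
      then show ?thesis
        using \<open>0 < e\<close> by (simp add: dist_norm power2_less_imp_less)
    qed
    then show "\<exists>N. \<forall>k\<ge>N. \<forall>l\<ge>N. dist (s k) (s l) < e"
      by blast
  qed
  then obtain p where p: "s \<longlonglongrightarrow> p"
    using Cauchy_convergent convergent_def by blast
  have pM: "p \<in> M"
    using closed_sequentially[OF closed_csubspaceD(1)[OF M]] s(1) p by blast
  have "(\<lambda>k. (norm (y - s k))\<^sup>2) \<longlonglongrightarrow> (norm (y - p))\<^sup>2"
    by (intro tendsto_intros p)
  moreover have "(\<lambda>k. d + 1 / real (Suc k)) \<longlonglongrightarrow> d + 0"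
    by (intro tendsto_intros LIMSEQ_Suc[OF lim_1_over_n, unfolded o_def])
  ultimately have "(norm (y - p))\<^sup>2 \<le> d + 0"
    by (rule LIMSEQ_le) (use s(2) less_imp_le in blast)
  then have min: "(norm (y - p))\<^sup>2 \<le> (norm (y - x))\<^sup>2" if "x \<in> M" for x
    using d_le[OF that] by linarith
  have "cinner (y - p) x = 0" if "x \<in> M" for x
  proof (cases "x = 0")
    case False
    \<comment> \<open>This c minimises the norm of (y - p) - c x. As p is already optimal, the gain
      |cinner (y - p) x|^2 / |x|^2 must be zero.\<close>
    define c where "c = cinner (y - p) x / complex_of_real ((norm x)\<^sup>2)"
    have "p + c *\<^sub>C x \<in> M"
      by (intro closed_csubspaceD[OF M] pM that)
    then have "(norm (y - p))\<^sup>2 \<le> (norm ((y - p) - c *\<^sub>C x))\<^sup>2"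
      using min by (metis diff_diff_add)
    moreover have "cinner (y - p) (c *\<^sub>C x) = complex_of_real ((cmod (cinner (y - p) x))\<^sup>2 / (norm x)\<^sup>2)"
      using complex_norm_square[of "cinner (y - p) x"] by (simp add: c_def cinner_scaleC_right mult.commute)
    moreover have "(norm (c *\<^sub>C x))\<^sup>2 = (cmod (cinner (y - p) x))\<^sup>2 / (norm x)\<^sup>2"
      using False by (simp add: c_def norm_divide power_mult_distrib power_divide field_simps power2_eq_square norm_mult)
    ultimately have "(cmod (cinner (y - p) x))\<^sup>2 / (norm x)\<^sup>2 \<le> 0"
      by (simp add: norm_diff_square del: of_real_divide of_real_power norm_scaleC)
    then show ?thesis
      using False by (simp add: divide_le_0_iff)
  qed simp
  with pM show ?thesis
    using that by blast
qed

text \<open>A vector minus its projection onto the closed span is orthogonal to \<open>V\<close>,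
  hence zero.\<close>

lemma closure_cspan_eq_UNIV:
  fixes V :: "'a::chilbert_space set"
  assumes "\<And>x. (\<And>v. v \<in> V \<Longrightarrow> cinner v x = 0) \<Longrightarrow> x = 0"
  shows "closure (cspan V) = UNIV"
proof -
  have M: "closed_csubspace (closure (cspan V))"
  proof (rule closed_csubspaceI)
    show "0 \<in> closure (cspan V)"
      using closure_subset complex_vector.span_zero by blast
  next
    fix x y assume "x \<in> closure (cspan V)" "y \<in> closure (cspan V)"
    then obtain f g where "\<And>n::nat. f n \<in> cspan V" "f \<longlonglongrightarrow> x" "\<And>n::nat. g n \<in> cspan V" "g \<longlonglongrightarrow> y"
      by (auto simp: closure_sequential)
    then show "x + y \<in> closure (cspan V)"
      unfolding closure_sequential
      by (intro exI[of _ "\<lambda>n. f n + g n"] conjI allI tendsto_add complex_vector.span_add)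
  next
    fix c x assume "x \<in> closure (cspan V)"
    then obtain f where "\<And>n::nat. f n \<in> cspan V" "f \<longlonglongrightarrow> x"
      by (auto simp: closure_sequential)
    then show "c *\<^sub>C x \<in> closure (cspan V)"
      unfolding closure_sequential
      by (intro exI[of _ "\<lambda>n. c *\<^sub>C f n"] conjI allI complex_vector.span_scale
          bounded_bilinear.tendsto[OF bounded_bilinear_scaleC] tendsto_const)
  qed simp
  have "y \<in> closure (cspan V)" for y
  proof -
    obtain p where p: "p \<in> closure (cspan V)" "\<And>x. x \<in> closure (cspan V) \<Longrightarrow> cinner (y - p) x = 0"
      using closed_csubspace_projection[OF M] by blast
    have "y - p = 0"
    proof (rule assms)
      fix v assume "v \<in> V"
      then have "v \<in> closure (cspan V)"
        using closure_subset complex_vector.span_base by blast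
      then show "cinner v (y - p) = 0"
        using p(2) cinner_eq_zero_commute by blast
    qed
    then show ?thesis
      using p(1) by simp
  qed
  then show ?thesis
    by blast
qed

section \<open>Holomorphic maps into a Hilbert space\<close>

text \<open>This is the differentiability clause of \<open>holomorphic_section\<close>; the form h d
  of the derivative expresses complex linearity.\<close>

definition vholomorphic_on :: "(complex \<Rightarrow> 'a::chilbert_space) \<Rightarrow> complex set \<Rightarrow> bool"
    (infixl "vholomorphic'_on" 50)
  where "f vholomorphic_on S \<longleftrightarrow> (\<forall>w\<in>S. \<exists>d. (f has_derivative (\<lambda>h. h *\<^sub>C d)) (at w))"

definition vderiv :: "(complex \<Rightarrow> 'a::chilbert_space) \<Rightarrow> complex \<Rightarrow> 'a"
  where "vderiv f w = (SOME d. (f has_derivative (\<lambda>h. h *\<^sub>C d)) (at w))"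

lemma has_derivative_vderiv:
  "f vholomorphic_on S \<Longrightarrow> w \<in> S \<Longrightarrow> (f has_derivative (\<lambda>h. h *\<^sub>C vderiv f w)) (at w)"
  unfolding vholomorphic_on_def vderiv_def by (rule someI_ex) blast

lemma vderiv_eqI:
  assumes "(f has_derivative (\<lambda>h. h *\<^sub>C d)) (at w)"
  shows "vderiv f w = d"
proof -
  have "(f has_derivative (\<lambda>h. h *\<^sub>C vderiv f w)) (at w)"
    using assms has_derivative_vderiv[of f "{w}" w] by (auto simp: vholomorphic_on_def)
  from has_derivative_unique[OF this assms] have "1 *\<^sub>C vderiv f w = 1 *\<^sub>C d"
    by metis
  then show ?thesis
    by simp
qed

lemma vholomorphic_on_subset: "f vholomorphic_on S \<Longrightarrow> S' \<subseteq> S \<Longrightarrow> f vholomorphic_on S'"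
  by (auto simp: vholomorphic_on_def)

lemma vholomorphic_on_imp_continuous_on: "f vholomorphic_on S \<Longrightarrow> continuous_on S f"
  unfolding continuous_on_eq_continuous_within
  by (meson continuous_at_imp_continuous_at_within has_derivative_continuous has_derivative_vderiv)

lemma bounded_linear_scaleC_left: "bounded_linear (\<lambda>c. c *\<^sub>C x)"
  for x :: "'a::chilbert_space"
  by (rule bounded_bilinear.bounded_linear_left[OF bounded_bilinear_scaleC])

lemma bounded_linear_cinner_left: "bounded_linear (\<lambda>y. cinner y x)"
  for x :: "'a::chilbert_space"
  by (rule bounded_bilinear.bounded_linear_left[OF bounded_bilinear_cinner])

lemma has_field_derivative_cinner_left:
  assumes "f vholomorphic_on S" and "w \<in> S"
  shows "((\<lambda>z. cinner (f z) x) has_field_derivative cinner (vderiv f w) x) (at w)"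
  using bounded_linear.has_derivative[OF bounded_linear_cinner_left has_derivative_vderiv[OF assms]]
  by (simp add: has_field_derivative_def cinner_scaleC_left mult.commute fun_eq_iff mult_commute_abs)

lemma holomorphic_on_cinner_left:
  assumes "f vholomorphic_on S" shows "(\<lambda>z. cinner (f z) x) holomorphic_on S"
  unfolding holomorphic_on_def field_differentiable_def
  using has_field_derivative_at_within[OF has_field_derivative_cinner_left[OF assms]] by blast

lemma deriv_cinner_left:
  "f vholomorphic_on S \<Longrightarrow> w \<in> S \<Longrightarrow> deriv (\<lambda>z. cinner (f z) x) w = cinner (vderiv f w) x"
  by (intro DERIV_imp_deriv has_field_derivative_cinner_left)

lemma vholomorphic_on_scaleC:
  assumes "\<phi> holomorphic_on S" and "f vholomorphic_on S" and "open S"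
  shows "(\<lambda>w. \<phi> w *\<^sub>C f w) vholomorphic_on S"
    and "w \<in> S \<Longrightarrow> vderiv (\<lambda>w. \<phi> w *\<^sub>C f w) w = \<phi> w *\<^sub>C vderiv f w + deriv \<phi> w *\<^sub>C f w"
proof -
  have *: "((\<lambda>w. \<phi> w *\<^sub>C f w) has_derivative (\<lambda>h. h *\<^sub>C (\<phi> w *\<^sub>C vderiv f w + deriv \<phi> w *\<^sub>C f w))) (at w)"
    if "w \<in> S" for w
  proof -
    have "(\<phi> has_derivative (\<lambda>h. h * deriv \<phi> w)) (at w)"
      using holomorphic_derivI[OF assms(1,3) that]
      by (simp add: has_field_derivative_def mult.commute mult_commute_abs)
    from bounded_bilinear.FDERIV[OF bounded_bilinear_scaleC this has_derivative_vderiv[OF assms(2) that]]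
    show ?thesis
      by (simp add: scaleC_add_right scaleC_scaleC mult.commute)
  qed
  then show "(\<lambda>w. \<phi> w *\<^sub>C f w) vholomorphic_on S"
    by (auto simp: vholomorphic_on_def)
  show "w \<in> S \<Longrightarrow> vderiv (\<lambda>w. \<phi> w *\<^sub>C f w) w = \<phi> w *\<^sub>C vderiv f w + deriv \<phi> w *\<^sub>C f w"
    by (rule vderiv_eqI[OF *])
qed

text \<open>Cauchy's estimates for \<open>\<lambda>z. cinner (f z) x\<close> are uniform in \<open>x\<close> of norm one, so that the
  difference quotients of \<open>vderiv f\<close> satisfy the Cauchy criterion in norm.\<close>

theorem vholomorphic_on_vderiv:
  fixes f :: "complex \<Rightarrow> 'a::chilbert_space"
  assumes hol: "f vholomorphic_on S" and "open S"
  shows "vderiv f vholomorphic_on S"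
  unfolding vholomorphic_on_def
proof
  fix w assume "w \<in> S"
  then obtain r' where r': "0 < r'" "cball w r' \<subseteq> S"
    using \<open>open S\<close> open_contains_cball by blast
  define r where "r = r' / 2"
  have r: "0 < r" "cball w (2 * r) \<subseteq> S"
    using r' by (auto simp: r_def)
  have "compact (f ` cball w (2 * r))"
    by (intro compact_continuous_image vholomorphic_on_imp_continuous_on
        vholomorphic_on_subset[OF hol r(2)] compact_cball)
  then obtain M where M: "0 < M" "\<And>z. z \<in> cball w (2 * r) \<Longrightarrow> norm (f z) \<le> M"
    using compact_imp_bounded bounded_pos by (metis imageI)
  \<comment> \<open>6 = 3!: this is Cauchy's bound for the third derivative of
    \<open>cinner (f z) x\<close> on discs of radius r, up to the factor \<open>norm x\<close>. The
    third derivative is the remainder term in the first-order expansion of the first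
    derivative.\<close>
  define B where "B = 6 * M / r ^ 3"
  have "0 \<le> B"
    using M r by (simp add: B_def)
  define d2 where "d2 x = deriv (deriv (\<lambda>z. cinner (f z) x)) w" for x
  have taylor: "cmod (cinner (vderiv f (w + h)) x - cinner (vderiv f w) x - h * d2 x)
      \<le> B * norm x * (cmod h)\<^sup>2" if "cmod h < r" for h x
  proof -
    define F where "F z = cinner (f z) x" for z
    have F: "F holomorphic_on S"
      unfolding F_def by (rule holomorphic_on_cinner_left[OF hol])
    have sub: "ball w r \<subseteq> S"
      using r by auto
    have "cmod ((deriv ^^ (Suc 0)) F (w + h) - (\<Sum>i\<le>1. (deriv ^^ Suc i) F w * (w + h - w) ^ i / fact i))
        \<le> (B * norm x) * cmod (w + h - w) ^ Suc 1 / fact 1"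
    proof (rule complex_Taylor[where S = "ball w r" and n = 1 and f = "\<lambda>i. (deriv ^^ Suc i) F"])
      fix i :: nat and z assume z: "z \<in> ball w r"
      have "(deriv ^^ Suc i) F holomorphic_on S"
        by (rule holomorphic_higher_deriv[OF F \<open>open S\<close>])
      then show "((deriv ^^ Suc i) F has_field_derivative (deriv ^^ Suc (Suc i)) F z) (at z within ball w r)"
        using has_field_derivative_at_within[OF holomorphic_derivI[OF _ \<open>open S\<close> subsetD[OF sub z]]]
        unfolding funpow.simps o_apply by blast
    next
      fix z assume z: "z \<in> ball w r"
      have zs: "cball z r \<subseteq> cball w (2 * r)"
      proof
        fix y assume "y \<in> cball z r"
        then show "y \<in> cball w (2 * r)"
          using z dist_triangle[of w y z] by (simp add: dist_commute)
      qed
      have "cmod ((deriv ^^ 3) F z) \<le> fact 3 * (M * norm x) / r ^ 3"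
      proof (rule Cauchy_inequality[OF _ _ r(1)])
        show "F holomorphic_on ball z r" "continuous_on (cball z r) F"
          using zs r(2) F holomorphic_on_imp_continuous_on
          by (meson ball_subset_cball continuous_on_subset holomorphic_on_subset order_trans)+
      next
        fix y assume "cmod (z - y) = r"
        then have "norm (f y) \<le> M"
          using zs M(2)[of y] by (auto simp: dist_norm)
        then show "cmod (F y) \<le> M * norm x"
          unfolding F_def by (meson Cauchy_Schwarz_cinner mult_right_mono norm_ge_zero order_trans)
      qed
      then show "cmod ((deriv ^^ Suc (Suc 1)) F z) \<le> B * norm x"
        by (simp add: B_def fact_numeral eval_nat_numeral)
    qed (use that r in \<open>auto simp: dist_norm\<close>)
    moreover have "deriv F (w + h) = cinner (vderiv f (w + h)) x" "deriv F w = cinner (vderiv f w) x"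
      unfolding F_def using that sub \<open>w \<in> S\<close>
      by (auto intro!: deriv_cinner_left[OF hol] simp: dist_norm subset_iff)
    ultimately show ?thesis
      by (simp add: d2_def F_def[abs_def] power2_eq_square algebra_simps)
  qed
  define q where "q h = (1 / h) *\<^sub>C (vderiv f (w + h) - vderiv f w)" for h
  have q: "cmod (cinner (q h) x - d2 x) \<le> B * cmod h * norm x" if "cmod h < r" "h \<noteq> 0" for h x
  proof -
    have "cinner (q h) x - d2 x = (1 / h) * (cinner (vderiv f (w + h)) x - cinner (vderiv f w) x - h * d2 x)"
      using that by (simp add: q_def cinner_scaleC_left cinner_diff_left field_simps)
    then have "cmod (cinner (q h) x - d2 x) \<le> (1 / cmod h) * (B * norm x * (cmod h)\<^sup>2)"
      using taylor[OF that(1), of x] by (simp add: norm_mult norm_divide divide_right_mono)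
    then show ?thesis
      using that by (simp add: power2_eq_square mult_ac)
  qed
  have qq: "norm (q h - q k) \<le> B * (cmod h + cmod k)"
    if "cmod h < r" "h \<noteq> 0" "cmod k < r" "k \<noteq> 0" for h k
  proof (rule norm_le_if_cinner_le)
    fix x
    have "cinner (q h - q k) x = (cinner (q h) x - d2 x) - (cinner (q k) x - d2 x)"
      by (simp add: cinner_diff_left)
    then have "cmod (cinner (q h - q k) x) \<le> B * cmod h * norm x + B * cmod k * norm x"
      using q[of h x] q[of k x] that norm_triangle_ineq4[of "cinner (q h) x - d2 x" "cinner (q k) x - d2 x"]
      by simp
    then show "cmod (cinner (q h - q k) x) \<le> B * (cmod h + cmod k) * norm x"
      by (simp add: algebra_simps)
  qed (use \<open>0 \<le> B\<close> in simp)
  \<comment> \<open>A sequence of admissible increments tending to 0. It only produces the limit d;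
    \<open>qd\<close> then controls all small h.\<close>
  define s where "s n = complex_of_real (r / real (Suc (Suc n)))" for n
  have s: "cmod (s n) < r" "s n \<noteq> 0" for n
    using r(1) by (simp_all add: s_def field_simps del: of_nat_Suc of_real_divide)
  have s0: "(\<lambda>n. cmod (s n)) \<longlonglongrightarrow> 0"
  proof -
    have "(\<lambda>n. r / real (Suc (Suc n))) \<longlonglongrightarrow> 0"
      using LIMSEQ_Suc[OF LIMSEQ_Suc[OF lim_const_over_n[of r]]] by simp
    then show ?thesis
      using r(1) by (simp add: s_def del: of_real_divide of_nat_Suc)
  qed
  have "Cauchy (\<lambda>n. q (s n))"
  proof (rule metric_CauchyI)
    fix e :: real assume "0 < e"
    have "(\<lambda>n. B * cmod (s n)) \<longlonglongrightarrow> B * 0"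
      by (intro tendsto_intros s0)
    then have "\<forall>\<^sub>F n in sequentially. B * cmod (s n) < e / 2"
      by (rule order_tendstoD) (use \<open>0 < e\<close> in simp)
    then obtain N where "\<And>n. N \<le> n \<Longrightarrow> B * cmod (s n) < e / 2"
      by (auto simp: eventually_sequentially)
    then have "dist (q (s m)) (q (s n)) < e" if "N \<le> m" "N \<le> n" for m n
      using qq[OF s s, of m n] that by (smt (verit, best) dist_norm distrib_left field_sum_of_halves)
    then show "\<exists>N. \<forall>m\<ge>N. \<forall>n\<ge>N. dist (q (s m)) (q (s n)) < e"
      by blast
  qed
  then obtain d where d: "(\<lambda>n. q (s n)) \<longlonglongrightarrow> d"
    using Cauchy_convergent convergent_def by blast
  have qd: "norm (q h - d) \<le> B * cmod h" if "cmod h < r" "h \<noteq> 0" for h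
  proof (rule LIMSEQ_le)
    show "(\<lambda>n. norm (q h - q (s n))) \<longlonglongrightarrow> norm (q h - d)"
      by (intro tendsto_intros d)
    have "(\<lambda>n. B * (cmod h + cmod (s n))) \<longlonglongrightarrow> B * (cmod h + 0)"
      by (intro tendsto_intros s0)
    then show "(\<lambda>n. B * (cmod h + cmod (s n))) \<longlonglongrightarrow> B * cmod h"
      by simp
    show "\<exists>N. \<forall>n\<ge>N. norm (q h - q (s n)) \<le> B * (cmod h + cmod (s n))"
      using qq[OF that s] by blast
  qed
  have "(vderiv f has_derivative (\<lambda>h. h *\<^sub>C d)) (at w)"
  proof (rule has_derivativeI_sandwich[OF r(1) bounded_linear_scaleC_left])
    fix y assume y: "y \<noteq> w" "dist y w < r"
    have "vderiv f y - vderiv f w - (y - w) *\<^sub>C d = (y - w) *\<^sub>C (q (y - w) - d)"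
      using y by (simp add: q_def complex_vector.scale_right_diff_distrib scaleC_scaleC)
    then show "norm (vderiv f y - vderiv f w - (y - w) *\<^sub>C d) / norm (y - w) \<le> B * cmod (y - w)"
      using y qd[of "y - w"] by (simp add: dist_norm)
  next
    have "((\<lambda>y. B * cmod (y - w)) \<longlongrightarrow> B * cmod (w - w)) (at w)"
      by (intro tendsto_intros)
    then show "((\<lambda>y. B * cmod (y - w)) \<longlongrightarrow> 0) (at w)"
      by simp
  qed
  then show "\<exists>d. (vderiv f has_derivative (\<lambda>h. h *\<^sub>C d)) (at w)"
    by blast
qed

lemma vholomorphic_on_higher_vderiv:
  "f vholomorphic_on S \<Longrightarrow> open S \<Longrightarrow> (vderiv ^^ k) f vholomorphic_on S"
  by (induction k) (simp_all add: vholomorphic_on_vderiv)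

lemma higher_deriv_cinner_left:
  assumes "f vholomorphic_on S" and "open S" and "w \<in> S"
  shows "(deriv ^^ k) (\<lambda>z. cinner (f z) x) w = cinner ((vderiv ^^ k) f w) x"
  using \<open>w \<in> S\<close>
proof (induction k arbitrary: w)
  case (Suc k)
  have "deriv ((deriv ^^ k) (\<lambda>z. cinner (f z) x)) w = deriv (\<lambda>z. cinner ((vderiv ^^ k) f z) x) w"
    by (intro complex_derivative_transform_within_open[OF _ _ \<open>open S\<close> Suc.prems] Suc.IH
        holomorphic_higher_deriv holomorphic_on_cinner_left vholomorphic_on_higher_vderiv assms)
  then show ?case
    using deriv_cinner_left[OF vholomorphic_on_higher_vderiv[OF assms(1,2), of k] Suc.prems] by simp
qed simp

text \<open>Pairing with the fixed vector \<open>t w\<close> reduces to scalars: near w, \<phi> is a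
  quotient of two holomorphic functions whose denominator does not vanish at w.\<close>

lemma holomorphic_on_scaleC_ratio:
  assumes s: "s vholomorphic_on S" and t: "t vholomorphic_on S" and "open S"
    and nz: "\<And>w. w \<in> S \<Longrightarrow> t w \<noteq> 0" and eq: "\<And>w. w \<in> S \<Longrightarrow> s w = \<phi> w *\<^sub>C t w"
  shows "\<phi> holomorphic_on S"
  unfolding holomorphic_on_open[OF \<open>open S\<close>]
proof
  fix w assume w: "w \<in> S"
  define S' where "S' = {z \<in> S. cinner (t z) (t w) \<noteq> 0}"
  have "continuous_on S (\<lambda>z. cinner (t z) (t w))"
    by (intro holomorphic_on_imp_continuous_on holomorphic_on_cinner_left t)
  then have "open S'"
    using continuous_open_preimage[OF _ \<open>open S\<close>, of "\<lambda>z. cinner (t z) (t w)" "- {0}"]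
    by (simp add: S'_def vimage_def Int_def open_Compl)
  moreover have "w \<in> S'"
    using w nz by (simp add: S'_def)
  moreover have "(\<lambda>z. cinner (s z) (t w) / cinner (t z) (t w)) holomorphic_on S'"
    by (intro holomorphic_intros holomorphic_on_cinner_left vholomorphic_on_subset[OF s]
        vholomorphic_on_subset[OF t]) (auto simp: S'_def)
  moreover have "cinner (s z) (t w) / cinner (t z) (t w) = \<phi> z" if "z \<in> S'" for z
    using that eq[of z] by (simp add: S'_def cinner_scaleC_left)
  ultimately show "\<exists>d. (\<phi> has_field_derivative d) (at w)"
    using has_field_derivative_transform_within_open[OF holomorphic_derivI] by blast
qed

section \<open>Curvature\<close>

lemma partial_x_eqI: "(F has_derivative F') (at w) \<Longrightarrow> partial_x F w = F' 1"
  and partial_y_eqI: "(F has_derivative F') (at w) \<Longrightarrow> partial_y F w = F' \<i>"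
proof -
  assume F: "(F has_derivative F') (at w)"
  interpret F': bounded_linear F'
    by (rule has_derivative_bounded_linear[OF F])
  have "((\<lambda>s. F (w + c * complex_of_real s)) has_derivative (\<lambda>s. F' (c * complex_of_real s))) (at 0)" for c
  proof -
    have "((\<lambda>s. w + c * complex_of_real s) has_derivative (\<lambda>s. c * complex_of_real s)) (at 0)"
      by (auto intro!: derivative_eq_intros)
    from diff_chain_at[OF this, of F F'] F show ?thesis
      by (simp add: o_def)
  qed
  moreover have "F' (c * complex_of_real s) = s *\<^sub>R F' c" for c s
    using F'.scaleR[of s c] by (simp add: scaleR_conv_of_real mult.commute)
  ultimately have *: "((\<lambda>s. F (w + c * complex_of_real s)) has_vector_derivative F' c) (at 0)" for c
    by (simp add: has_vector_derivative_def)
  show "partial_x F w = F' 1" "partial_y F w = F' \<i>"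
    using *[of 1] *[of \<i>] by (simp_all add: partial_x_def partial_y_def vector_derivative_at)
qed

lemma d_w_eqI: "(F has_derivative F') (at w) \<Longrightarrow> d_w F w = (F' 1 - \<i> * F' \<i>) / 2"
  by (simp add: d_w_def partial_x_eqI partial_y_eqI)

lemma d_wbar_eqI: "(F has_derivative F') (at w) \<Longrightarrow> d_wbar F w = (F' 1 + \<i> * F' \<i>) / 2"
  by (simp add: d_wbar_def partial_x_eqI partial_y_eqI)

text \<open>The Cauchy-Riemann equation says that the real-linear derivative takes at \<i> the value
  \<i> times its value at 1, so it is complex linear.\<close>

lemma has_field_derivative_if_d_wbar_eq_0:
  assumes F: "(F has_derivative F') (at w)" and "d_wbar F w = 0"
  shows "(F has_field_derivative F' 1) (at w)"
proof -
  interpret F': bounded_linear F'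
    by (rule has_derivative_bounded_linear[OF F])
  have "F' 1 + \<i> * F' \<i> = 0"
    using assms d_wbar_eqI[OF F] by simp
  then have i: "F' \<i> = \<i> * F' 1"
    by (auto simp: complex_eq_iff)
  have "F' h = F' 1 * h" for h
  proof -
    have "Re h *\<^sub>R 1 + Im h *\<^sub>R \<i> = h"
      by (simp add: complex_eq_iff)
    moreover have "F' (Re h *\<^sub>R 1 + Im h *\<^sub>R \<i>) = Re h *\<^sub>R F' 1 + Im h *\<^sub>R F' \<i>"
      by (simp only: F'.add F'.scaleR)
    ultimately have "F' h = Re h *\<^sub>R F' 1 + Im h *\<^sub>R F' \<i>"
      by simp
    also have "\<dots> = F' 1 * h"
      by (simp add: i complex_eq_iff algebra_simps)
    finally show ?thesis .
  qed
  then have "F' = (*) (F' 1)" ..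
  with F show ?thesis
    unfolding has_field_derivative_def by (rule back_subst)
qed

text \<open>The Wirtinger derivative of $\log\|f\|^2$.\<close>

definition log_grad :: "(complex \<Rightarrow> 'a::chilbert_space) \<Rightarrow> complex \<Rightarrow> complex"
  where "log_grad f w = cinner (vderiv f w) (f w) / complex_of_real ((norm (f w))\<^sup>2)"

lemma has_derivative_ln_norm:
  assumes "f vholomorphic_on S" and "w \<in> S" and "f w \<noteq> 0"
  shows "((\<lambda>z. ln ((norm (f z))\<^sup>2)) has_derivative (\<lambda>h. 2 * Re (h * log_grad f w))) (at w)"
proof -
  have norm_eq: "(norm (f z))\<^sup>2 = Re (cinner (f z) (f z))" for z
    by (simp add: cinner_self del: of_real_power)
  note D = has_derivative_vderiv[OF assms(1,2)]
  have "((\<lambda>z. (norm (f z))\<^sup>2) has_derivative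
      (\<lambda>h. Re (cinner (f w) (h *\<^sub>C vderiv f w) + cinner (h *\<^sub>C vderiv f w) (f w)))) (at w)"
    unfolding norm_eq
    by (intro bounded_linear.has_derivative[OF bounded_linear_Re]
        bounded_bilinear.FDERIV[OF bounded_bilinear_cinner D D])
  moreover have "Re (cinner (f w) (h *\<^sub>C vderiv f w) + cinner (h *\<^sub>C vderiv f w) (f w)) =
      2 * Re (h * cinner (vderiv f w) (f w))" for h
  proof -
    have "cinner (f w) (h *\<^sub>C vderiv f w) = cnj (h * cinner (vderiv f w) (f w))"
      using cinner_commute[of "f w" "vderiv f w"] by (simp add: cinner_scaleC_right)
    then show ?thesis
      by (simp add: cinner_scaleC_left)
  qed
  ultimately have D2: "((\<lambda>z. (norm (f z))\<^sup>2) has_derivative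
      (\<lambda>h. 2 * Re (h * cinner (vderiv f w) (f w)))) (at w)"
    by simp
  have "(ln has_derivative (*) (1 / (norm (f w))\<^sup>2)) (at ((norm (f w))\<^sup>2))"
    using DERIV_ln_divide[of "(norm (f w))\<^sup>2"] assms(3) by (simp add: has_field_derivative_def)
  from diff_chain_at[OF D2 this] have "((\<lambda>z. ln ((norm (f z))\<^sup>2)) has_derivative
      (\<lambda>h. 1 / (norm (f w))\<^sup>2 * (2 * Re (h * cinner (vderiv f w) (f w))))) (at w)"
    unfolding o_def .
  moreover have "1 / (norm (f w))\<^sup>2 * (2 * Re (h * cinner (vderiv f w) (f w))) = 2 * Re (h * log_grad f w)" for h
    by (simp add: log_grad_def Re_divide_of_real del: of_real_power)
  ultimately show ?thesis
    by simp
qed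

text \<open>Only real differentiability can be expected, since \<open>cinner\<close> is conjugate
  linear in its second argument. The numerator contains \<open>vderiv f\<close>, which is
  differentiable by \<open>vholomorphic_on_vderiv\<close>.\<close>

lemma log_grad_differentiable:
  assumes "f vholomorphic_on S" and "open S" and "w \<in> S" and "f w \<noteq> 0"
  shows "\<exists>q'. (log_grad f has_derivative q') (at w)"
proof -
  note D = has_derivative_vderiv[OF assms(1,3)]
  note D' = has_derivative_vderiv[OF vholomorphic_on_vderiv[OF assms(1,2)] assms(3)]
  have nz: "cinner (f w) (f w) \<noteq> 0"
    using assms(4) by simp
  have "((\<lambda>z. cinner (vderiv f z) (f z) / cinner (f z) (f z)) has_derivative
      (\<lambda>h. - cinner (vderiv f w) (f w) * (inverse (cinner (f w) (f w))
         * (cinner (f w) (h *\<^sub>C vderiv f w) + cinner (h *\<^sub>C vderiv f w) (f w))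
         * inverse (cinner (f w) (f w)))
         + (cinner (vderiv f w) (h *\<^sub>C vderiv f w) + cinner (h *\<^sub>C vderiv (vderiv f) w) (f w)) / cinner (f w) (f w))) (at w)"
    by (rule has_derivative_divide[OF bounded_bilinear.FDERIV[OF bounded_bilinear_cinner D' D]
          bounded_bilinear.FDERIV[OF bounded_bilinear_cinner D D] nz])
  then show ?thesis
    unfolding log_grad_def[abs_def] cinner_self[symmetric] by blast
qed

text \<open>For a real function the \<open>d_wbar\<close> derivative is the conjugate of the
  \<open>d_w\<close> derivative, here \<open>log_grad f\<close>; and conjugation exchanges
  \<open>d_w\<close> with \<open>d_wbar\<close>. Equality of curvatures thus becomes equality of
  \<open>d_wbar\<close> of the logarithmic gradients.\<close>

lemma laplace_ln_norm:
  assumes "f vholomorphic_on S" and "open S" and "w \<in> S" and nz: "\<And>z. z \<in> S \<Longrightarrow> f z \<noteq> 0"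
  shows "d_w (d_wbar (\<lambda>z. complex_of_real (ln ((norm (f z))\<^sup>2)))) w = cnj (d_wbar (log_grad f) w)"
proof -
  let ?F = "\<lambda>z. complex_of_real (ln ((norm (f z))\<^sup>2))"
  have F: "d_wbar ?F z = cnj (log_grad f z)" if "z \<in> S" for z
  proof -
    have "(?F has_derivative (\<lambda>h. complex_of_real (2 * Re (h * log_grad f z)))) (at z)"
      by (intro bounded_linear.has_derivative[OF bounded_linear_of_real]
          has_derivative_ln_norm[OF assms(1) that] nz that)
    from d_wbar_eqI[OF this] show ?thesis
      by (simp add: complex_eq_iff)
  qed
  obtain q' where q': "(log_grad f has_derivative q') (at w)"
    using log_grad_differentiable[OF assms(1-3)] nz assms(3) by blast
  have "((\<lambda>z. cnj (log_grad f z)) has_derivative (\<lambda>h. cnj (q' h))) (at w)"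
    by (rule bounded_linear.has_derivative[OF bounded_linear_cnj q'])
  then have "(d_wbar ?F has_derivative (\<lambda>h. cnj (q' h))) (at w)"
    by (rule has_derivative_transform_within_open[OF _ assms(2,3)]) (simp add: F)
  from d_w_eqI[OF this] show ?thesis
    by (simp add: d_wbar_eqI[OF q'])
qed

text \<open>The factor \<phi> adds its logarithmic derivative to \<open>log_grad f\<close>, a
  holomorphic term that \<open>d_wbar\<close> annihilates.\<close>

lemma d_wbar_log_grad_scaleC:
  assumes "\<phi> holomorphic_on S" and f: "f vholomorphic_on S" and "open S" and w: "w \<in> S"
    and nz: "\<And>z. z \<in> S \<Longrightarrow> \<phi> z \<noteq> 0" "\<And>z. z \<in> S \<Longrightarrow> f z \<noteq> 0"
    and g: "\<And>z. z \<in> S \<Longrightarrow> g z = \<phi> z *\<^sub>C f z"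
  shows "d_wbar (log_grad g) w = d_wbar (log_grad f) w"
proof -
  note hol = vholomorphic_on_scaleC[OF assms(1,2,3)]
  have eq: "deriv \<phi> z / \<phi> z + log_grad f z = log_grad g z" if z: "z \<in> S" for z
  proof -
    have "(g has_derivative (\<lambda>h. h *\<^sub>C vderiv (\<lambda>w. \<phi> w *\<^sub>C f w) z)) (at z)"
      by (rule has_derivative_transform_within_open[OF has_derivative_vderiv[OF hol(1) z] \<open>open S\<close> z])
         (simp add: g)
    then have "vderiv g z = \<phi> z *\<^sub>C vderiv f z + deriv \<phi> z *\<^sub>C f z"
      using hol(2)[OF z] by (simp add: vderiv_eqI)
    moreover have "complex_of_real ((norm (g z))\<^sup>2) = \<phi> z * cnj (\<phi> z) * cinner (f z) (f z)"
      unfolding g[OF z] cinner_self[symmetric] cinner_scaleC_left cinner_scaleC_right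
      by (simp only: ac_simps)
    ultimately show ?thesis
      using z nz by (simp add: log_grad_def g cinner_add_left cinner_scaleC_left cinner_scaleC_right
          cinner_self[symmetric] field_simps del: of_real_power)
  qed
  obtain q' where q': "(log_grad f has_derivative q') (at w)"
    using log_grad_differentiable[OF f \<open>open S\<close> w] nz w by blast
  have "(\<lambda>z. deriv \<phi> z / \<phi> z) holomorphic_on S"
    by (intro holomorphic_intros assms(1,3) nz)
  then obtain d where d: "((\<lambda>z. deriv \<phi> z / \<phi> z) has_derivative (*) d) (at w)"
    using holomorphic_derivI[OF _ \<open>open S\<close> w] by (auto simp: has_field_derivative_def)
  have "(log_grad g has_derivative (\<lambda>h. d * h + q' h)) (at w)"
    by (rule has_derivative_transform_within_open[OF has_derivative_add[OF d q'] \<open>open S\<close> w eq])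
  from d_wbar_eqI[OF this] show ?thesis
    by (simp add: d_wbar_eqI[OF q'] algebra_simps)
qed

text \<open>The difference of the logarithms of the squared norms is harmonic, hence twice the real part
  of a holomorphic function.\<close>

lemma norm_ratio_holomorphic:
  fixes f :: "complex \<Rightarrow> 'a::chilbert_space" and g :: "complex \<Rightarrow> 'b::chilbert_space"
  assumes f: "f vholomorphic_on ball c r" and g: "g vholomorphic_on ball c r"
    and nz: "\<And>z. z \<in> ball c r \<Longrightarrow> f z \<noteq> 0" "\<And>z. z \<in> ball c r \<Longrightarrow> g z \<noteq> 0"
    and eq: "\<And>z. z \<in> ball c r \<Longrightarrow> d_wbar (log_grad f) z = d_wbar (log_grad g) z"
  obtains \<phi> where "\<phi> holomorphic_on ball c r" and "\<And>z. \<phi> z \<noteq> 0"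
    and "\<And>z. z \<in> ball c r \<Longrightarrow> norm (f z) = cmod (\<phi> z) * norm (g z)"
proof -
  define q where "q z = log_grad f z - log_grad g z" for z
  have "q holomorphic_on ball c r"
    unfolding holomorphic_on_open[OF open_ball]
  proof
    fix z assume z: "z \<in> ball c r"
    obtain F where F: "(log_grad f has_derivative F) (at z)"
      using log_grad_differentiable[OF f open_ball z] nz z by blast
    obtain G where G: "(log_grad g has_derivative G) (at z)"
      using log_grad_differentiable[OF g open_ball z] nz z by blast
    have q: "(q has_derivative (\<lambda>h. F h - G h)) (at z)"
      unfolding q_def[abs_def] by (intro has_derivative_diff F G)
    have "d_wbar q z = d_wbar (log_grad f) z - d_wbar (log_grad g) z"
      unfolding d_wbar_eqI[OF q] d_wbar_eqI[OF F] d_wbar_eqI[OF G] by (simp add: field_simps)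
    then have "d_wbar q z = 0"
      using eq[OF z] by simp
    then show "\<exists>d. (q has_field_derivative d) (at z)"
      using has_field_derivative_if_d_wbar_eq_0[OF q] by blast
  qed
  then obtain Q where "\<And>z. z \<in> ball c r \<Longrightarrow> (Q has_field_derivative q z) (at z within ball c r)"
    using holomorphic_convex_primitive'[OF convex_ball open_ball] by blast
  then have Q: "(Q has_field_derivative q z) (at z)" if "z \<in> ball c r" for z
    using that at_within_open[OF that open_ball] by metis
  define u where "u z = ln ((norm (f z))\<^sup>2) - ln ((norm (g z))\<^sup>2) - 2 * Re (Q z)" for z
  have "(u has_derivative (\<lambda>h. 0)) (at z)" if z: "z \<in> ball c r" for z
  proof -
    have "(u has_derivative (\<lambda>h. 2 * Re (h * log_grad f z) - 2 * Re (h * log_grad g z) - 2 * Re (q z * h))) (at z)"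
      unfolding u_def[abs_def]
      by (intro has_derivative_diff has_derivative_ln_norm[OF f z] has_derivative_ln_norm[OF g z] nz z
          has_derivative_mult_right bounded_linear.has_derivative[OF bounded_linear_Re])
         (use Q[OF z] in \<open>simp add: has_field_derivative_def\<close>)
    then show ?thesis
      by (simp add: q_def algebra_simps)
  qed
  then obtain C where C: "u z = C" if "z \<in> ball c r" for z
    using has_derivative_zero_constant[OF convex_ball, of c r u] has_derivative_at_withinI by metis
  \<comment> \<open>The difference of the logarithms of the squared norms is 2 Re Q + C; halving it
    gives the logarithm of the ratio of the norms.\<close>
  define \<phi> where "\<phi> z = exp (Q z + complex_of_real (C / 2))" for z
  show ?thesis
  proof
    have "Q holomorphic_on ball c r"
      unfolding holomorphic_on_open[OF open_ball] using Q by blast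
    then show "\<phi> holomorphic_on ball c r"
      unfolding \<phi>_def[abs_def] by (intro holomorphic_intros)
    show "\<phi> z \<noteq> 0" for z
      by (simp add: \<phi>_def)
    fix z assume z: "z \<in> ball c r"
    have pos: "0 < norm (f z)" "0 < norm (g z)"
      using nz z by auto
    have "ln (norm (f z)) = Re (Q z) + C / 2 + ln (norm (g z))"
      using C[OF z] pos by (simp add: u_def ln_realpow power2_eq_square ln_mult)
    then have "norm (f z) = exp (Re (Q z) + C / 2 + ln (norm (g z)))"
      using pos by (metis exp_ln)
    then show "norm (f z) = cmod (\<phi> z) * norm (g z)"
      using pos by (simp add: \<phi>_def exp_add norm_mult)
  qed
qed

section \<open>Polarisation of holomorphic kernels\<close>

text \<open>The conjugation inside b cancels the conjugate linearity of \<open>cinner\<close> in its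
  second argument, so the derivative is complex linear in h.\<close>

lemma holomorphic_on_cinner_cnj:
  assumes a: "a vholomorphic_on S" and b: "b vholomorphic_on S" and "open D"
    and p: "p holomorphic_on D" "p ` D \<subseteq> S" and q: "q holomorphic_on D" "(\<lambda>x. cnj (q x)) ` D \<subseteq> S"
  shows "(\<lambda>x. cinner (a (p x)) (b (cnj (q x)))) holomorphic_on D"
  unfolding holomorphic_on_open[OF \<open>open D\<close>]
proof
  fix x assume x: "x \<in> D"
  define p' q' where "p' = deriv p x" and "q' = deriv q x"
  have "(p has_derivative (\<lambda>h. p' * h)) (at x)" "(q has_derivative (\<lambda>h. q' * h)) (at x)"
    using holomorphic_derivI[OF p(1) \<open>open D\<close> x] holomorphic_derivI[OF q(1) \<open>open D\<close> x]
    by (simp_all add: has_field_derivative_def p'_def q'_def)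
  then have pd: "(p has_derivative (\<lambda>h. p' * h)) (at x)"
    and qd: "((\<lambda>x. cnj (q x)) has_derivative (\<lambda>h. cnj (q' * h))) (at x)"
    using bounded_linear.has_derivative[OF bounded_linear_cnj] by blast+
  have "p x \<in> S" "cnj (q x) \<in> S"
    using p q x by auto
  note A = has_derivative_vderiv[OF a this(1)] and B = has_derivative_vderiv[OF b this(2)]
  have "((\<lambda>x. cinner (a (p x)) (b (cnj (q x)))) has_derivative
      (\<lambda>h. cinner (a (p x)) (cnj (q' * h) *\<^sub>C vderiv b (cnj (q x)))
         + cinner ((p' * h) *\<^sub>C vderiv a (p x)) (b (cnj (q x))))) (at x)"
    using bounded_bilinear.FDERIV[OF bounded_bilinear_cinner diff_chain_at[OF pd A] diff_chain_at[OF qd B]]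
    by (simp add: o_def)
  moreover have "cinner (a (p x)) (cnj (q' * h) *\<^sub>C vderiv b (cnj (q x)))
         + cinner ((p' * h) *\<^sub>C vderiv a (p x)) (b (cnj (q x))) =
      (q' * cinner (a (p x)) (vderiv b (cnj (q x))) + p' * cinner (vderiv a (p x)) (b (cnj (q x)))) * h" for h
    by (simp add: cinner_scaleC_left cinner_scaleC_right algebra_simps)
  ultimately show "\<exists>d. ((\<lambda>x. cinner (a (p x)) (b (cnj (q x)))) has_field_derivative d) (at x)"
    unfolding has_field_derivative_def by (metis (no_types, lifting) ext)
qed

text \<open>The real diameter accumulates at 0, so the identity theorem applies.\<close>

lemma holomorphic_zero_on_reals:
  assumes "f holomorphic_on ball 0 r" and zero: "\<And>s. \<bar>s\<bar> < r \<Longrightarrow> f (complex_of_real s) = 0"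
    and z: "z \<in> ball 0 r"
  shows "f z = 0"
proof (rule analytic_continuation[OF assms(1) open_ball connected_ball _ _ _ _ z])
  have "0 < r"
    using z norm_ge_zero[of z] unfolding mem_ball_0 by linarith
  show "complex_of_real ` {- r<..<r} \<subseteq> ball 0 r" "0 \<in> ball 0 r"
    using \<open>0 < r\<close> by auto
  show "0 islimpt complex_of_real ` {- r<..<r}"
    unfolding islimpt_approachable
  proof (intro allI impI)
    fix e :: real assume "0 < e"
    then show "\<exists>x'\<in>complex_of_real ` {- r<..<r}. x' \<noteq> 0 \<and> dist x' 0 < e"
      using \<open>0 < r\<close> by (intro bexI[of _ "complex_of_real (min (e / 2) (r / 2))"]) (auto simp: min_def)
  qed
qed (use zero in auto)

text \<open>With \<open>w = c + (x + \<i> y)\<close> and \<open>cnj z = cnj c + (x - \<i> y)\<close>, the diagonal \<open>w = z\<close> is the set of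
  real \<open>x\<close> and \<open>y\<close>, and both kernels are holomorphic in \<open>x\<close> and in \<open>y\<close>.\<close>

lemma cinner_eq_if_norm_eq:
  fixes a :: "complex \<Rightarrow> 'a::chilbert_space" and b :: "complex \<Rightarrow> 'b::chilbert_space"
  assumes a: "a vholomorphic_on ball c r" and b: "b vholomorphic_on ball c r"
    and eq: "\<And>z. z \<in> ball c r \<Longrightarrow> norm (a z) = norm (b z)"
    and w: "w \<in> ball c (r / 2)" and z: "z \<in> ball c (r / 2)"
  shows "cinner (a w) (a z) = cinner (b w) (b z)"
proof -
  define P where "P x y = c + (x + \<i> * y)" for x y
  define Q where "Q x y = cnj c + (x - \<i> * y)" for x y
  define k where "k x y = cinner (a (P x y)) (a (cnj (Q x y))) - cinner (b (P x y)) (b (cnj (Q x y)))" for x y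
  \<comment> \<open>Half the radius ensures |x + \<i> y| \<le> |x| + |y| < r.\<close>
  let ?D = "ball 0 (r / 2) :: complex set"
  have P: "P x y \<in> ball c r" if "x \<in> ?D" "y \<in> ?D" for x y
  proof -
    have "cmod (x + \<i> * y) < r"
      using that norm_triangle_ineq[of x "\<i> * y"] by (simp add: norm_mult)
    moreover have "dist c (P x y) = cmod (x + \<i> * y)"
      using norm_minus_cancel[of "x + \<i> * y"] by (simp add: P_def dist_norm)
    ultimately show ?thesis
      by simp
  qed
  have Q: "cnj (Q x y) \<in> ball c r" if "x \<in> ?D" "y \<in> ?D" for x y
  proof -
    have "cnj (Q x y) = P (cnj x) (cnj y)"
      by (simp add: P_def Q_def)
    then show ?thesis
      using P[of "cnj x" "cnj y"] that by simp
  qed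
  have hol: "(\<lambda>x. k x y) holomorphic_on ?D" "(\<lambda>x. k y x) holomorphic_on ?D" if "y \<in> ?D" for y
    unfolding k_def using that P Q
    by (intro holomorphic_on_diff holomorphic_on_cinner_cnj[OF a a] holomorphic_on_cinner_cnj[OF b b] open_ball;
        force simp: P_def Q_def intro!: holomorphic_intros)+
  have real: "k (complex_of_real s) (complex_of_real u) = 0" if "\<bar>s\<bar> < r / 2" "\<bar>u\<bar> < r / 2" for s u
  proof -
    have "cnj (Q (complex_of_real s) (complex_of_real u)) = P (complex_of_real s) (complex_of_real u)"
      by (simp add: P_def Q_def)
    then show ?thesis
      using P[of "complex_of_real s" "complex_of_real u"] that eq by (simp add: k_def cinner_self)
  qed
  have "k x (complex_of_real u) = 0" if "x \<in> ?D" "\<bar>u\<bar> < r / 2" for x u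
    by (rule holomorphic_zero_on_reals[OF hol(1) _ that(1)]) (use that real in auto)
  then have k: "k x y = 0" if "x \<in> ?D" "y \<in> ?D" for x y
    by (rule holomorphic_zero_on_reals[OF hol(2)[OF that(1)] _ that(2)]) (use that in auto)
  \<comment> \<open>These solve \<open>P x y = w\<close> and \<open>cnj (Q x y) = z\<close>. Their
    moduli are at most the mean of |w - c| and |z - c|, so both lie in the half-radius disc.\<close>
  define x where "x = ((w - c) + cnj (z - c)) / 2"
  define y where "y = ((w - c) - cnj (z - c)) / (2 * \<i>)"
  have "cmod (w - c) < r / 2" "cmod (cnj (z - c)) < r / 2"
    using w z unfolding complex_mod_cnj by (simp_all add: dist_norm norm_minus_commute)
  then have "x \<in> ?D" "y \<in> ?D"
    using norm_triangle_ineq[of "w - c" "cnj (z - c)"] norm_triangle_ineq4[of "w - c" "cnj (z - c)"]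
    by (simp_all add: x_def y_def norm_divide norm_mult)
  moreover have "P x y = w" "cnj (Q x y) = z"
    by (simp_all add: P_def Q_def x_def y_def field_simps)
  ultimately show ?thesis
    using k[of x y] by (simp add: k_def)
qed

section \<open>Bounded operators and orthogonal projections\<close>

lemma bounded_operatorD:
  assumes "bounded_operator M N A"
  shows "x \<in> M \<Longrightarrow> A x \<in> N" and "x \<in> M \<Longrightarrow> y \<in> M \<Longrightarrow> A (x + y) = A x + A y"
    and "x \<in> M \<Longrightarrow> A (c *\<^sub>C x) = c *\<^sub>C A x"
  using assms by (auto simp: bounded_operator_def)

lemma bounded_operator_UNIV_imp_bounded_linear:
  assumes "bounded_operator UNIV UNIV A" shows "bounded_linear A"
proof -
  obtain K where "\<And>x. norm (A x) \<le> norm x * K"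
    using assms unfolding bounded_operator_def by (metis UNIV_I mult.commute)
  then show ?thesis
    using bounded_operatorD[OF assms]
    by (intro bounded_linear_intro) (auto simp flip: scaleC_of_real)
qed

lemma bounded_operator_UNIV_iff:
  "bounded_operator UNIV UNIV A \<longleftrightarrow> bounded_linear A \<and> (\<forall>c x. A (c *\<^sub>C x) = c *\<^sub>C A x)"
proof
  assume "bounded_operator UNIV UNIV A"
  then show "bounded_linear A \<and> (\<forall>c x. A (c *\<^sub>C x) = c *\<^sub>C A x)"
    using bounded_operator_UNIV_imp_bounded_linear bounded_operatorD(3) by blast
next
  assume A: "bounded_linear A \<and> (\<forall>c x. A (c *\<^sub>C x) = c *\<^sub>C A x)"
  then interpret bounded_linear A
    by blast
  show "bounded_operator UNIV UNIV A"
    unfolding bounded_operator_def using A add bounded by (auto simp: mult.commute)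
qed

lemma bounded_operator_compose:
  assumes A: "bounded_operator M N A" and B: "bounded_operator L M B"
  shows "bounded_operator L N (\<lambda>x. A (B x))"
proof -
  obtain K where K: "\<And>x. x \<in> M \<Longrightarrow> norm (A x) \<le> K * norm x"
    using A unfolding bounded_operator_def by blast
  obtain K' where K': "\<And>x. x \<in> L \<Longrightarrow> norm (B x) \<le> K' * norm x"
    using B unfolding bounded_operator_def by blast
  have "norm (A (B x)) \<le> \<bar>K\<bar> * K' * norm x" if "x \<in> L" for x
  proof -
    have "norm (A (B x)) \<le> K * norm (B x)"
      using K bounded_operatorD(1)[OF B that] by blast
    also have "\<dots> \<le> \<bar>K\<bar> * norm (B x)"
      by (simp add: mult_right_mono)
    also have "\<dots> \<le> \<bar>K\<bar> * (K' * norm x)"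
      using K'[OF that] by (simp add: mult_left_mono)
    finally show ?thesis
      by (simp add: mult.assoc)
  qed
  moreover have "(\<lambda>x. A (B x)) ` L \<subseteq> N"
    using bounded_operatorD(1)[OF A] bounded_operatorD(1)[OF B] by blast
  ultimately show ?thesis
    unfolding bounded_operator_def[of L N]
    by (auto simp: bounded_operatorD[OF B] bounded_operatorD[OF A])
qed

lemma bounded_operator_range: "bounded_operator M N A \<Longrightarrow> bounded_operator M UNIV A"
  by (auto simp: bounded_operator_def)

lemma bounded_operator_zero: "bounded_operator UNIV UNIV (\<lambda>x. 0)"
  by (simp add: bounded_operator_UNIV_iff bounded_linear_zero)

lemma bounded_operator_add:
  assumes "bounded_operator UNIV UNIV A" and "bounded_operator UNIV UNIV B"
  shows "bounded_operator UNIV UNIV (\<lambda>x. A x + B x)"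
  using assms by (simp add: bounded_operator_UNIV_iff bounded_linear_add scaleC_add_right)

lemma bounded_operator_diff:
  assumes "bounded_operator UNIV UNIV A" and "bounded_operator UNIV UNIV B"
  shows "bounded_operator UNIV UNIV (\<lambda>x. A x - B x)"
  using assms
  by (simp add: bounded_operator_UNIV_iff bounded_linear_sub complex_vector.scale_right_diff_distrib)

lemma bounded_operator_scaleC:
  assumes "bounded_operator UNIV UNIV A"
  shows "bounded_operator UNIV UNIV (\<lambda>x. c *\<^sub>C A x)"
  using assms bounded_linear_compose[OF bounded_bilinear.bounded_linear_right[OF bounded_bilinear_scaleC, of c], of A]
  by (simp add: bounded_operator_UNIV_iff scaleC_scaleC mult.commute)

lemma bounded_operator_sum:
  assumes "\<And>i. i \<in> I \<Longrightarrow> bounded_operator UNIV UNIV (A i)"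
  shows "bounded_operator UNIV UNIV (\<lambda>x. \<Sum>i\<in>I. A i x)"
  using assms
  by (induction I rule: infinite_finite_induct) (auto intro: bounded_operator_zero bounded_operator_add)

lemma bounded_operator_id: "bounded_operator UNIV UNIV (\<lambda>x. x)"
  by (simp add: bounded_operator_UNIV_iff bounded_linear_ident)

lemma bounded_operator_funpow:
  "bounded_operator UNIV UNIV A \<Longrightarrow> bounded_operator UNIV UNIV (A ^^ k)"
  for A :: "'a::chilbert_space \<Rightarrow> 'a"
proof (induction k)
  case 0
  then show ?case
    by (simp add: id_def bounded_operator_id)
next
  case (Suc k)
  then show ?case
    using bounded_operator_compose[of UNIV UNIV A UNIV "A ^^ k"] by (simp add: o_def)
qed

text \<open>The two conditions determine p uniquely (\<open>cproj_eqI\<close>); linearity follows by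
  checking them for the candidate value.\<close>

definition cproj :: "'a::chilbert_space set \<Rightarrow> 'a \<Rightarrow> 'a"
  where "cproj M x = (SOME p. p \<in> M \<and> (\<forall>y\<in>M. cinner (x - p) y = 0))"

lemma
  assumes "closed_csubspace M"
  shows cproj_in: "cproj M x \<in> M" and cinner_diff_cproj: "y \<in> M \<Longrightarrow> cinner (x - cproj M x) y = 0"
proof -
  have "\<exists>p. p \<in> M \<and> (\<forall>y\<in>M. cinner (x - p) y = 0)"
    using closed_csubspace_projection[OF assms] by metis
  from someI_ex[OF this] show "cproj M x \<in> M" "y \<in> M \<Longrightarrow> cinner (x - cproj M x) y = 0"
    unfolding cproj_def by blast+
qed

lemma cproj_eqI:
  assumes M: "closed_csubspace M" and "p \<in> M" and "\<And>y. y \<in> M \<Longrightarrow> cinner (x - p) y = 0"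
  shows "cproj M x = p"
proof -
  have *: "cproj M x - p \<in> M"
    by (intro closed_csubspaceD[OF M] cproj_in[OF M] assms)
  have "cproj M x - p = (x - p) - (x - cproj M x)"
    by simp
  then have "cinner (cproj M x - p) (cproj M x - p) = 0"
    using assms(3)[OF *] cinner_diff_cproj[OF M *] by (metis cinner_diff_left diff_zero)
  then show ?thesis
    by simp
qed

lemma cproj_ident: "closed_csubspace M \<Longrightarrow> x \<in> M \<Longrightarrow> cproj M x = x"
  by (rule cproj_eqI) auto

lemma bounded_operator_cproj:
  assumes M: "closed_csubspace M"
  shows "bounded_operator UNIV M (cproj M)"
  unfolding bounded_operator_def
proof (intro conjI ballI allI exI[of _ 1])
  show "cproj M (x + y) = cproj M x + cproj M y" for x y
  proof (rule cproj_eqI[OF M])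
    fix z assume "z \<in> M"
    have "x + y - (cproj M x + cproj M y) = (x - cproj M x) + (y - cproj M y)"
      by simp
    then show "cinner (x + y - (cproj M x + cproj M y)) z = 0"
      using cinner_diff_cproj[OF M \<open>z \<in> M\<close>] by (metis add_0 cinner_add_left)
  qed (intro closed_csubspaceD[OF M] cproj_in[OF M])
  show "cproj M (c *\<^sub>C x) = c *\<^sub>C cproj M x" for c x
  proof (rule cproj_eqI[OF M])
    fix z assume "z \<in> M"
    then show "cinner (c *\<^sub>C x - c *\<^sub>C cproj M x) z = 0"
      using cinner_diff_cproj[OF M] by (simp add: cinner_scaleC_left flip: complex_vector.scale_right_diff_distrib)
  qed (intro closed_csubspaceD[OF M] cproj_in[OF M])
  show "norm (cproj M x) \<le> 1 * norm x" for x
  proof -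
    have "(norm x)\<^sup>2 = (norm (x - cproj M x))\<^sup>2 + (norm (cproj M x))\<^sup>2"
      using norm_add_square[of "x - cproj M x" "cproj M x"]
        cinner_diff_cproj[OF M cproj_in[OF M]] by simp
    then have "(norm (cproj M x))\<^sup>2 \<le> (norm x)\<^sup>2"
      by simp
    from power2_le_imp_le[OF this] show ?thesis
      by simp
  qed
qed (use cproj_in[OF M] in auto)

lemma closed_csubspace_vimage:
  assumes A: "bounded_operator UNIV UNIV A" and M: "closed_csubspace M"
  shows "closed_csubspace (A -` M)"
proof (rule closed_csubspaceI)
  interpret bounded_linear A
    by (rule bounded_operator_UNIV_imp_bounded_linear[OF A])
  show "closed (A -` M)"
    by (intro closed_vimage closed_csubspaceD[OF M] continuous_on continuous_on_id)
  show "0 \<in> A -` M"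
    using closed_csubspaceD(2)[OF M] by (simp add: zero)
qed (use bounded_operatorD[OF A] closed_csubspaceD[OF M] in auto)

section \<open>Sections span the space\<close>

lemma vderiv_transform_within_open:
  assumes "f vholomorphic_on S" and "open S" and "w \<in> S" and "\<And>z. z \<in> S \<Longrightarrow> f z = g z"
  shows "vderiv g w = vderiv f w"
  by (rule vderiv_eqI[OF has_derivative_transform_within_open[OF has_derivative_vderiv]]) (use assms in auto)

lemma vderiv_add:
  assumes "f vholomorphic_on S" and "g vholomorphic_on S" and "w \<in> S"
  shows "vderiv (\<lambda>z. f z + g z) w = vderiv f w + vderiv g w"
  using has_derivative_add[OF has_derivative_vderiv[OF assms(1,3)] has_derivative_vderiv[OF assms(2,3)]]
  by (intro vderiv_eqI) (simp add: scaleC_add_right)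

lemma
  assumes A: "bounded_operator UNIV UNIV A" and f: "f vholomorphic_on S"
  shows vholomorphic_on_bounded_operator: "(\<lambda>z. A (f z)) vholomorphic_on S"
    and vderiv_bounded_operator: "w \<in> S \<Longrightarrow> vderiv (\<lambda>z. A (f z)) w = A (vderiv f w)"
proof -
  have *: "((\<lambda>z. A (f z)) has_derivative (\<lambda>h. h *\<^sub>C A (vderiv f w))) (at w)" if "w \<in> S" for w
    using bounded_linear.has_derivative[OF bounded_operator_UNIV_imp_bounded_linear[OF A] has_derivative_vderiv[OF f that]]
    by (simp add: bounded_operatorD(3)[OF A])
  then show "(\<lambda>z. A (f z)) vholomorphic_on S"
    by (auto simp: vholomorphic_on_def)
  show "w \<in> S \<Longrightarrow> vderiv (\<lambda>z. A (f z)) w = A (vderiv f w)"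
    by (rule vderiv_eqI[OF *])
qed

lemma holomorphic_sectionD:
  assumes "holomorphic_section \<Omega> M T t"
  shows "t vholomorphic_on \<Omega>" and "w \<in> \<Omega> \<Longrightarrow> t w \<in> M" and "w \<in> \<Omega> \<Longrightarrow> T (t w) = w *\<^sub>C t w"
  using assms by (auto simp: holomorphic_section_def vholomorphic_on_def eigenspace_def)

text \<open>A basis of the eigenspace has one element, and x and v are both multiples of it.\<close>

lemma eigenspace_multiple:
  assumes "cowen_douglas 1 \<Omega> M T" and "w \<in> \<Omega>" and "v \<in> eigenspace M T w" and "v \<noteq> 0"
    and "x \<in> eigenspace M T w"
  obtains c where "x = c *\<^sub>C v"
proof -
  obtain B where B: "eigenspace M T w \<subseteq> cspan B" "card B = cdim (eigenspace M T w)"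
    using complex_vector.basis_exists[of "eigenspace M T w"] by metis
  then have "card B = 1"
    using assms(1,2) by (simp add: cowen_douglas_def)
  then obtain b where "B = {b}"
    by (auto simp: card_1_singleton_iff)
  then obtain k l where k: "v = k *\<^sub>C b" and l: "x = l *\<^sub>C b"
    using B(1) assms(3,5) unfolding \<open>B = {b}\<close> complex_vector.span_singleton by blast
  have "k \<noteq> 0"
    using assms(4) k by auto
  then have "x = (l / k) *\<^sub>C v"
    by (simp add: k l scaleC_scaleC)
  then show ?thesis
    using that by blast
qed

lemma eq_0_if_cinner_eigenspace:
  assumes T: "cowen_douglas 1 \<Omega> M T" and x: "x \<in> M"
    and orth: "\<And>w y. w \<in> \<Omega> \<Longrightarrow> y \<in> eigenspace M T w \<Longrightarrow> cinner y x = 0"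
  shows "x = 0"
proof -
  have N: "closed_csubspace {y. \<forall>z\<in>{x}. cinner y z = 0}"
    by (rule closed_csubspace_orthogonal)
  have "M = closure (cspan (\<Union>w\<in>\<Omega>. eigenspace M T w))"
    using T by (simp add: cowen_douglas_def)
  also have "\<dots> \<subseteq> {y. \<forall>z\<in>{x}. cinner y z = 0}"
    by (intro closure_minimal complex_vector.span_minimal)
      (use orth N in \<open>auto simp: closed_csubspace_def\<close>)
  finally have "cinner x x = 0"
    using x by blast
  then show ?thesis
    by simp
qed

text \<open>Differentiating \<open>(T - w) (t w) = 0\<close> repeatedly shows that the first non-zero derivative of a
  section at a zero is again an eigenvector.\<close>

lemma section_orthogonal:
  assumes T: "cowen_douglas 1 \<Omega> M T" and \<Omega>: "open \<Omega>" "connected \<Omega>"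
    and t: "holomorphic_section \<Omega> M T t" and w\<^sub>1: "w\<^sub>1 \<in> \<Omega>" "t w\<^sub>1 \<noteq> 0"
    and D: "open D" "D \<noteq> {}" "D \<subseteq> \<Omega>" and x: "x \<in> M"
    and orth: "\<And>w. w \<in> D \<Longrightarrow> cinner (t w) x = 0"
  shows "x = 0"
proof (rule eq_0_if_cinner_eigenspace[OF T x])
  fix w y assume w: "w \<in> \<Omega>" and y: "y \<in> eigenspace M T w"
  note t = holomorphic_sectionD[OF t]
  have M: "closed_csubspace M" and TM: "bounded_operator M M T"
    using T by (auto simp: cowen_douglas_def)
  \<comment> \<open>\<open>T\<close> is controlled only on \<open>M\<close>. Composing it with the
    projection gives a bounded operator on the whole space, through which \<open>vderiv\<close> can
    be pulled.\<close>
  define P where "P = cproj M"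
  have P: "bounded_operator UNIV UNIV P"
    unfolding P_def by (rule bounded_operator_range[OF bounded_operator_cproj[OF M]])
  have R: "bounded_operator UNIV UNIV (\<lambda>x. T (P x))"
    unfolding P_def
    by (rule bounded_operator_range[OF bounded_operator_compose[OF TM bounded_operator_cproj[OF M]]])
  define s where "s k = (vderiv ^^ k) t" for k
  have s: "s k vholomorphic_on \<Omega>" for k
    unfolding s_def by (rule vholomorphic_on_higher_vderiv[OF t(1) \<Omega>(1)])
  have sSuc: "s (Suc k) = vderiv (s k)" for k
    by (simp add: s_def)
  have Ps: "P (s k z) = s k z" if "z \<in> \<Omega>" for k z
    using that
  proof (induction k arbitrary: z)
    case 0
    then show ?case
      using cproj_ident[OF M t(2)] by (simp add: P_def s_def)
  next
    case (Suc k)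
    have "vderiv (s k) z = vderiv (\<lambda>z. P (s k z)) z"
      by (rule vderiv_transform_within_open[OF vholomorphic_on_bounded_operator[OF P s] \<Omega>(1) Suc.prems Suc.IH])
    then show ?case
      using vderiv_bounded_operator[OF P s Suc.prems] by (simp add: sSuc)
  qed
  \<comment> \<open>The k-th derivative of T t = z t by the Leibniz rule. For k = 0 the truncated
    index k - 1 is harmless because its coefficient is 0.\<close>
  have Rs: "T (P (s k z)) = z *\<^sub>C s k z + of_nat k *\<^sub>C s (k - 1) z" if "z \<in> \<Omega>" for k z
    using that
  proof (induction k arbitrary: z)
    case 0
    then show ?case
      using t(3) Ps[of z 0] by (simp add: s_def)
  next
    case (Suc k)
    have id: "(\<lambda>z. z *\<^sub>C s k z) vholomorphic_on \<Omega>"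
      "vderiv (\<lambda>z. z *\<^sub>C s k z) z = z *\<^sub>C s (Suc k) z + s k z"
      using vholomorphic_on_scaleC[OF holomorphic_on_ident s \<Omega>(1)] Suc.prems by (simp_all add: sSuc)
    have const: "(\<lambda>z. of_nat k *\<^sub>C s (k - 1) z) vholomorphic_on \<Omega>"
      "vderiv (\<lambda>z. of_nat k *\<^sub>C s (k - 1) z) z = of_nat k *\<^sub>C vderiv (s (k - 1)) z"
      using vholomorphic_on_scaleC[OF holomorphic_on_const s \<Omega>(1)] Suc.prems by simp_all
    have k: "of_nat k *\<^sub>C vderiv (s (k - 1)) z = of_nat k *\<^sub>C s k z"
      by (cases k) (simp_all add: sSuc)
    have "T (P (s (Suc k) z)) = vderiv (\<lambda>z. T (P (s k z))) z"
      using vderiv_bounded_operator[OF R s Suc.prems] by (simp add: sSuc)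
    also have "\<dots> = vderiv (\<lambda>z. z *\<^sub>C s k z + of_nat k *\<^sub>C s (k - 1) z) z"
      by (rule vderiv_transform_within_open[symmetric, OF vholomorphic_on_bounded_operator[OF R s] \<Omega>(1) Suc.prems Suc.IH])
    also have "\<dots> = z *\<^sub>C s (Suc k) z + s k z + of_nat k *\<^sub>C s k z"
      using vderiv_add[OF id(1) const(1) Suc.prems] id(2) const(2) k by simp
    finally show ?case
      by (simp add: scaleC_add_left add.assoc)
  qed
  \<comment> \<open>Orthogonality on \<open>D\<close> extends to \<Omega> by analytic continuation,
    and then to all derivatives at w.\<close>
  have zero: "cinner (s k w) x = 0" for k
  proof -
    define F where "F z = cinner (t z) x" for z
    have F: "F holomorphic_on \<Omega>"
      unfolding F_def by (rule holomorphic_on_cinner_left[OF t(1)])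
    obtain d where d: "d \<in> D"
      using D(2) by blast
    have "F z = 0" if "z \<in> \<Omega>" for z
      using analytic_continuation[OF F \<Omega> D(3) _ _ _ that, of d] d D orth interior_limit_point[of d D]
      by (auto simp: F_def interior_open)
    then have "(deriv ^^ k) F w = (deriv ^^ k) (\<lambda>z. 0) w"
      by (intro higher_deriv_transform_within_open[OF F _ \<Omega>(1) w]) auto
    also have "\<dots> = 0"
      by (simp add: higher_deriv_const)
    finally show ?thesis
      using higher_deriv_cinner_left[OF t(1) \<Omega>(1) w, of k x] by (simp add: F_def[abs_def] s_def)
  qed
  \<comment> \<open>Otherwise the holomorphic function \<open>cinner (t z) (t w\<^sub>1)\<close> has
    all derivatives zero at w and vanishes on the connected set \<Omega>, also at
    \<open>w\<^sub>1\<close>.\<close>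
  have "\<exists>k. s k w \<noteq> 0"
  proof (rule ccontr)
    assume "\<nexists>k. s k w \<noteq> 0"
    then have "(deriv ^^ k) (\<lambda>z. cinner (t z) (t w\<^sub>1)) w = 0" for k
      using higher_deriv_cinner_left[OF t(1) \<Omega>(1) w] by (simp add: s_def)
    from holomorphic_fun_eq_0_on_connected[OF holomorphic_on_cinner_left[OF t(1)] \<Omega> this w w\<^sub>1(1)] w\<^sub>1(2)
    show False
      by simp
  qed
  then obtain k where k: "s k w \<noteq> 0" and least: "\<And>j. j < k \<Longrightarrow> s j w = 0"
    using exists_least_iff[of "\<lambda>k. s k w \<noteq> 0"] by blast
  have "of_nat k *\<^sub>C s (k - 1) w = 0"
    using least[of "k - 1"] by (cases "k = 0") auto
  then have "T (s k w) = w *\<^sub>C s k w"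
    using Rs[OF w, of k] Ps[OF w, of k] by simp
  moreover have "s k w \<in> M"
    using cproj_in[OF M, of "s k w"] Ps[OF w, of k] by (simp add: P_def)
  ultimately have "s k w \<in> eigenspace M T w"
    by (simp add: eigenspace_def)
  from eigenspace_multiple[OF T w this k y] obtain c where "y = c *\<^sub>C s k w" .
  then show "cinner y x = 0"
    using zero by (simp add: cinner_scaleC_left)
qed

text \<open>The component of a vector of \<open>M\<close> orthogonal to \<open>M \<inter> N\<close>
  is orthogonal to all \<open>t w\<close> with w in \<open>D\<close>, hence zero by
  \<open>section_orthogonal\<close>.\<close>

theorem section_total:
  assumes T: "cowen_douglas 1 \<Omega> M T" and \<Omega>: "open \<Omega>" "connected \<Omega>"
    and t: "holomorphic_section \<Omega> M T t" and w\<^sub>1: "w\<^sub>1 \<in> \<Omega>" "t w\<^sub>1 \<noteq> 0"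
    and D: "open D" "D \<noteq> {}" "D \<subseteq> \<Omega>" and N: "closed_csubspace N"
    and tN: "\<And>w. w \<in> D \<Longrightarrow> t w \<in> N"
  shows "M \<subseteq> N"
proof
  fix y assume y: "y \<in> M"
  have M: "closed_csubspace M"
    using T by (simp add: cowen_douglas_def)
  have MN: "closed_csubspace (M \<inter> N)"
    by (rule closed_csubspace_Int[OF M N])
  have "y - cproj (M \<inter> N) y = 0"
  proof (rule section_orthogonal[OF T \<Omega> t w\<^sub>1 D])
    show "y - cproj (M \<inter> N) y \<in> M"
      using cproj_in[OF MN, of y] y by (intro closed_csubspaceD[OF M]) auto
    fix w assume "w \<in> D"
    then have "t w \<in> M \<inter> N"
      using tN holomorphic_sectionD(2)[OF t] D(3) by blast
    then show "cinner (t w) (y - cproj (M \<inter> N) y) = 0"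
      using cinner_diff_cproj[OF MN] cinner_eq_zero_commute by blast
  qed
  then show "y \<in> N"
    using cproj_in[OF MN, of y] by simp
qed

section \<open>Unitaries from equal Gram matrices\<close>

text \<open>Pairs of linear combinations of the two families with the same coefficients. A relation
  is used because the map from the first member to the second is well defined only once the Gram
  matrices are known to agree.\<close>

inductive gram_pair :: "'i set \<Rightarrow> ('i \<Rightarrow> 'a::chilbert_space) \<Rightarrow> ('i \<Rightarrow> 'b::chilbert_space) \<Rightarrow> 'a \<Rightarrow> 'b \<Rightarrow> bool"
  for I v v' where
  zero: "gram_pair I v v' 0 0"
| step: "gram_pair I v v' x y \<Longrightarrow> i \<in> I \<Longrightarrow> gram_pair I v v' (c *\<^sub>C v i + x) (c *\<^sub>C v' i + y)"

lemma gram_pair_add: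
  assumes "gram_pair I v v' x y" and "gram_pair I v v' x' y'"
  shows "gram_pair I v v' (x + x') (y + y')"
  using assms by (induction rule: gram_pair.induct) (auto simp: add.assoc intro: gram_pair.intros)

lemma gram_pair_scaleC: "gram_pair I v v' x y \<Longrightarrow> gram_pair I v v' (c *\<^sub>C x) (c *\<^sub>C y)"
  by (induction rule: gram_pair.induct)
    (auto simp: scaleC_add_right scaleC_scaleC intro: gram_pair.intros)

lemma gram_pair_diff:
  assumes "gram_pair I v v' x y" and "gram_pair I v v' x' y'"
  shows "gram_pair I v v' (x - x') (y - y')"
  using gram_pair_add[OF assms(1) gram_pair_scaleC[OF assms(2), of "-1"]]
  by (simp add: complex_vector.scale_minus_left)

lemma gram_pair_commute: "gram_pair I v v' x y \<Longrightarrow> gram_pair I v' v y x"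
  by (induction rule: gram_pair.induct) (auto intro: gram_pair.intros)

lemma gram_pair_cspan:
  assumes "x \<in> cspan (v ` I)" shows "\<exists>y. gram_pair I v v' x y"
  using assms
proof (induction rule: complex_vector.span_induct_alt)
  case base
  then show ?case
    using gram_pair.zero by blast
next
  case (step c x y)
  then obtain i z where "i \<in> I" "x = v i" "gram_pair I v v' y z"
    by auto
  then show ?case
    using gram_pair.step[of I v v' y z i c] by auto
qed

lemma cinner_gram_pair:
  assumes gram: "\<forall>i\<in>I. \<forall>j\<in>I. cinner (v i) (v j) = cinner (v' i) (v' j)"
    and "gram_pair I v v' x y" and "gram_pair I v v' x' y'"
  shows "cinner x x' = cinner y y'"
proof -
  have *: "cinner x (v i) = cinner y (v' i)" if "i \<in> I" for i
    using assms(2) that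
    by (induction rule: gram_pair.induct) (simp_all add: cinner_add_left cinner_scaleC_left gram)
  show ?thesis
    using assms(3)
    by (induction rule: gram_pair.induct) (simp_all add: cinner_add_right cinner_scaleC_right *)
qed

text \<open>The closure of \<open>gram_pair\<close> in the product space. For total families with
  equal Gram matrices it is the graph of the unitary.\<close>

definition gram_closure :: "'i set \<Rightarrow> ('i \<Rightarrow> 'a::chilbert_space) \<Rightarrow> ('i \<Rightarrow> 'b::chilbert_space) \<Rightarrow> 'a \<Rightarrow> 'b \<Rightarrow> bool"
  where "gram_closure I v v' x y \<longleftrightarrow>
    (\<exists>s s'. (\<forall>n::nat. gram_pair I v v' (s n) (s' n)) \<and> s \<longlonglongrightarrow> x \<and> s' \<longlonglongrightarrow> y)"

lemma gram_closureI:
  assumes "\<And>n::nat. gram_pair I v v' (s n) (s' n)" and "s \<longlonglongrightarrow> x" and "s' \<longlonglongrightarrow> y"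
  shows "gram_closure I v v' x y"
  using assms unfolding gram_closure_def by blast

lemma gram_closureE:
  assumes "gram_closure I v v' x y"
  obtains s s' where "\<And>n::nat. gram_pair I v v' (s n) (s' n)" and "s \<longlonglongrightarrow> x" and "s' \<longlonglongrightarrow> y"
proof -
  obtain s s' where "(\<forall>n::nat. gram_pair I v v' (s n) (s' n)) \<and> s \<longlonglongrightarrow> x \<and> s' \<longlonglongrightarrow> y"
    using assms unfolding gram_closure_def by (elim exE)
  then show ?thesis
    using that[of s s'] by simp
qed

lemma gram_closure_commute: "gram_closure I v v' x y \<Longrightarrow> gram_closure I v' v y x"
  by (elim gram_closureE) (rule gram_closureI[OF gram_pair_commute])

lemma gram_closure_add:
  assumes "gram_closure I v v' x y" and "gram_closure I v v' x' y'"
  shows "gram_closure I v v' (x + x') (y + y')"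
  using assms by (elim gram_closureE) (rule gram_closureI[OF gram_pair_add tendsto_add tendsto_add])

lemma gram_closure_diff:
  assumes "gram_closure I v v' x y" and "gram_closure I v v' x' y'"
  shows "gram_closure I v v' (x - x') (y - y')"
  using assms by (elim gram_closureE) (rule gram_closureI[OF gram_pair_diff tendsto_diff tendsto_diff])

lemma gram_closure_scaleC:
  assumes "gram_closure I v v' x y" shows "gram_closure I v v' (c *\<^sub>C x) (c *\<^sub>C y)"
  using assms
  by (elim gram_closureE)
    (rule gram_closureI[OF gram_pair_scaleC bounded_bilinear.tendsto[OF bounded_bilinear_scaleC tendsto_const]
        bounded_bilinear.tendsto[OF bounded_bilinear_scaleC tendsto_const]])

lemma gram_closure_base:
  assumes "i \<in> I" shows "gram_closure I v v' (v i) (v' i)"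
proof -
  have "gram_pair I v v' (v i) (v' i)"
    using gram_pair.step[OF gram_pair.zero assms, of v v' 1] by simp
  then show ?thesis
    using gram_closureI[where s = "\<lambda>_. v i" and s' = "\<lambda>_. v' i"] tendsto_const by blast
qed

lemma cinner_gram_closure:
  assumes gram: "\<forall>i\<in>I. \<forall>j\<in>I. cinner (v i) (v j) = cinner (v' i) (v' j)"
    and "gram_closure I v v' x y" and "gram_closure I v v' x' y'"
  shows "cinner x x' = cinner y y'"
proof -
  obtain s s' where s: "\<And>n::nat. gram_pair I v v' (s n) (s' n)" "s \<longlonglongrightarrow> x" "s' \<longlonglongrightarrow> y"
    by (rule gram_closureE[OF assms(2)]) (rule that)
  obtain r r' where r: "\<And>n::nat. gram_pair I v v' (r n) (r' n)" "r \<longlonglongrightarrow> x'" "r' \<longlonglongrightarrow> y'"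
    by (rule gram_closureE[OF assms(3)]) (rule that)
  have "(\<lambda>n. cinner (s n) (r n)) \<longlonglongrightarrow> cinner x x'"
    by (intro bounded_bilinear.tendsto[OF bounded_bilinear_cinner] s r)
  moreover have "(\<lambda>n. cinner (s n) (r n)) \<longlonglongrightarrow> cinner y y'"
    unfolding cinner_gram_pair[OF gram s(1) r(1)]
    by (intro bounded_bilinear.tendsto[OF bounded_bilinear_cinner] s r)
  ultimately show ?thesis
    by (rule LIMSEQ_unique)
qed

lemma norm_eq_if_cinner_eq:
  fixes x :: "'a::chilbert_space" and y :: "'b::chilbert_space"
  assumes "cinner x x = cinner y y" shows "norm x = norm y"
proof -
  have "(norm x)\<^sup>2 = (norm y)\<^sup>2"
    using assms by (simp only: cinner_self of_real_eq_iff)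
  then show ?thesis
    by (simp add: power2_eq_iff_nonneg)
qed

text \<open>Approximate x by combinations of the \<open>v i\<close>. The partner combinations have
  the same mutual distances, so they form a Cauchy sequence too.\<close>

lemma gram_closure_total:
  assumes gram: "\<forall>i\<in>I. \<forall>j\<in>I. cinner (v i) (v j) = cinner (v' i) (v' j)"
    and "closure (cspan (v ` I)) = UNIV"
  shows "\<exists>y. gram_closure I v v' x y"
proof -
  have "x \<in> closure (cspan (v ` I))"
    using assms(2) by simp
  then obtain s where s: "\<And>n::nat. s n \<in> cspan (v ` I)" "s \<longlonglongrightarrow> x"
    unfolding closure_sequential by blast
  have "\<forall>n. \<exists>y. gram_pair I v v' (s n) y"
    using gram_pair_cspan[OF s(1)] by blast
  then obtain s' where s': "\<And>n. gram_pair I v v' (s n) (s' n)"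
    by metis
  have "norm (s' m - s' n) = norm (s m - s n)" for m n
    using cinner_gram_pair[OF gram gram_pair_diff[OF s' s'] gram_pair_diff[OF s' s']]
    by (intro norm_eq_if_cinner_eq) simp
  then have "Cauchy s'"
    using LIMSEQ_imp_Cauchy[OF s(2)] by (simp add: Cauchy_def dist_norm)
  then obtain y where "s' \<longlonglongrightarrow> y"
    using Cauchy_convergent convergent_def by blast
  then show ?thesis
    using gram_closureI[OF s' s(2)] by blast
qed

text \<open>Isometry makes \<open>gram_closure\<close> single-valued. As the relation is symmetric
  in the two families, totality of the second one gives surjectivity.\<close>

theorem unitary_if_gram_eq:
  fixes v :: "'i \<Rightarrow> 'a::chilbert_space" and v' :: "'i \<Rightarrow> 'b::chilbert_space"
  assumes gram: "\<forall>i\<in>I. \<forall>j\<in>I. cinner (v i) (v j) = cinner (v' i) (v' j)"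
    and total: "closure (cspan (v ` I)) = UNIV" "closure (cspan (v' ` I)) = UNIV"
  obtains U where "unitary U" and "\<And>i. i \<in> I \<Longrightarrow> U (v i) = v' i"
proof -
  let ?C = "gram_closure I v v'"
  obtain U where U: "\<And>x. ?C x (U x)"
    using gram_closure_total[OF gram total(1)] by metis
  have unique: "U x = y" if "?C x y" for x y
  proof -
    have "norm (U x - y) = norm (x - x)"
      using cinner_gram_closure[OF gram gram_closure_diff[OF U that] gram_closure_diff[OF U that], of x x]
      by (intro norm_eq_if_cinner_eq) simp
    then show ?thesis
      by simp
  qed
  have cinner_U: "cinner (U x) (U y) = cinner x y" for x y
    using cinner_gram_closure[OF gram U U] by simp
  then have norm_U: "norm (U x) = norm x" for x
    by (intro norm_eq_if_cinner_eq)
  have "surj U"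
    unfolding surj_def
  proof
    fix y
    obtain x where "gram_closure I v' v y x"
      using gram_closure_total[OF _ total(2), of v y] gram by auto
    then show "\<exists>x. y = U x"
      using unique gram_closure_commute by metis
  qed
  moreover have "bounded_operator UNIV UNIV U"
    unfolding bounded_operator_def
    using unique[OF gram_closure_add[OF U U]] unique[OF gram_closure_scaleC[OF U]]
    by (auto simp: norm_U intro: exI[of _ 1])
  ultimately have "unitary U"
    by (simp add: unitary_def cinner_U)
  moreover have "U (v i) = v' i" if "i \<in> I" for i
    by (rule unique[OF gram_closure_base[OF that]])
  ultimately show ?thesis
    using that by blast
qed

section \<open>A Kleinecke--Shirokov estimate on eigenvectors\<close>

text \<open>The commutator with \<open>B\<close> is a derivation sending \<open>X\<close> to
  \<open>Y\<close> and \<open>Y\<close> to 0, so \<open>B\<close> to the power k + 1 produces k + 1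
  equal terms.\<close>

lemma commutator_power:
  fixes B X Y :: "'a::chilbert_space \<Rightarrow> 'a"
  assumes B: "bounded_linear B" and X: "bounded_linear X"
    and XY: "\<And>x. B (X x) = X (B x) + Y x" and BY: "\<And>x. B (Y x) = Y (B x)"
  shows "(B ^^ Suc k) (X u) = X ((B ^^ Suc k) u) + real (Suc k) *\<^sub>R Y ((B ^^ k) u)"
proof (induction k)
  case (Suc k)
  interpret B: bounded_linear B by (rule B)
  have "(B ^^ Suc (Suc k)) (X u) = B ((B ^^ Suc k) (X u))"
    by simp
  also have "\<dots> = B (X ((B ^^ Suc k) u)) + real (Suc k) *\<^sub>R B (Y ((B ^^ k) u))"
    unfolding Suc.IH B.add B.scaleR ..
  also have "\<dots> = X ((B ^^ Suc (Suc k)) u) + real (Suc (Suc k)) *\<^sub>R Y ((B ^^ Suc k) u)"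
    by (simp add: XY BY algebra_simps scaleR_2)
  finally show ?case .
qed (simp add: XY)

lemma commutator_power_eigenvector:
  fixes B X Y :: "'a::chilbert_space \<Rightarrow> 'a"
  assumes B: "bounded_linear B" and X: "bounded_linear X"
    and XY: "\<And>x. B (X x) = X (B x) + Y x" and BY: "\<And>x. B (Y x) = Y (B x)" and v: "B v = 0"
  shows "(B ^^ k) ((X ^^ k) v) = fact k *\<^sub>R (Y ^^ k) v"
proof (induction k)
  case (Suc k)
  interpret B: bounded_linear B by (rule B)
  interpret X: bounded_linear X by (rule X)
  have Y: "Y (c *\<^sub>R x) = c *\<^sub>R Y x" for c x
    using XY[of x] XY[of "c *\<^sub>R x"] by (simp add: X.scaleR B.scaleR algebra_simps)
  \<comment> \<open>\<open>Y\<close> commutes with \<open>B\<close>, so it preserves the kernel of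
    \<open>B\<close>; by the induction hypothesis this kills the first term of
    \<open>commutator_power\<close>.\<close>
  have BY0: "B ((Y ^^ k) v) = 0" for k
  proof (induction k)
    case (Suc k)
    then show ?case
      using Y[of 0 0] by (simp add: BY)
  qed (simp add: v)
  have "(B ^^ Suc k) ((X ^^ Suc k) v) = (B ^^ Suc k) (X ((X ^^ k) v))"
    by simp
  also have "\<dots> = X (B ((B ^^ k) ((X ^^ k) v))) + real (Suc k) *\<^sub>R Y ((B ^^ k) ((X ^^ k) v))"
    unfolding commutator_power[OF B X XY BY] by simp
  also have "\<dots> = fact (Suc k) *\<^sub>R (Y ^^ Suc k) v"
    unfolding Suc.IH by (simp add: B.scaleR BY0 X.zero Y algebra_simps)
  finally show ?case .
qed simp

lemma norm_funpow_le:
  fixes A :: "'a::real_normed_vector \<Rightarrow> 'a"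
  assumes "bounded_linear A"
  obtains K where "0 \<le> K" and "\<And>k x. norm ((A ^^ k) x) \<le> K ^ k * norm x"
proof -
  obtain K where K: "0 \<le> K" "\<And>x. norm (A x) \<le> norm x * K"
    using bounded_linear.nonneg_bounded[OF assms] by blast
  have "norm ((A ^^ k) x) \<le> K ^ k * norm x" for k x
  proof (induction k)
    case (Suc k)
    have "norm (A ((A ^^ k) x)) \<le> norm ((A ^^ k) x) * K"
      by (rule K)
    also have "\<dots> \<le> K ^ k * norm x * K"
      using Suc K(1) by (rule mult_right_mono)
    finally show ?case
      by (simp add: mult_ac)
  qed simp
  with K(1) show ?thesis
    using that by blast
qed

text \<open>By \<open>commutator_power_eigenvector\<close>, k! Y^k v has norm at most const^k,
  whereas Y^k v equals c^k v modulo \<open>F\<close>. Hence the coset v + \<open>F\<close> contains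
  vectors c^(-k) Y^k v tending to 0, and \<open>F\<close> is closed. Working modulo \<open>F\<close>
  matters because the eigenvector relation is later known only up to lower terms of the
  flag.\<close>

theorem commutator_no_eigenvalue:
  fixes B X Y :: "'a::chilbert_space \<Rightarrow> 'a"
  assumes B: "bounded_operator UNIV UNIV B" and X: "bounded_operator UNIV UNIV X"
    and XY: "\<And>x. B (X x) = X (B x) + Y x" and BY: "\<And>x. B (Y x) = Y (B x)" and v: "B v = 0"
    and F: "closed_csubspace F" "\<And>x. x \<in> F \<Longrightarrow> Y x \<in> F"
    and Yv: "Y v - c *\<^sub>C v \<in> F" and "c \<noteq> 0"
  shows "v \<in> F"
proof -
  note lin = bounded_operator_UNIV_imp_bounded_linear[OF B] bounded_operator_UNIV_imp_bounded_linear[OF X]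
  obtain K where K: "0 \<le> K" "\<And>k x. norm ((B ^^ k) x) \<le> K ^ k * norm x"
    using norm_funpow_le[OF lin(1)] by blast
  obtain L where L: "0 \<le> L" "\<And>k x. norm ((X ^^ k) x) \<le> L ^ k * norm x"
    using norm_funpow_le[OF lin(2)] by blast
  have "Y = (\<lambda>x. B (X x) - X (B x))"
    by (simp add: XY)
  then have "bounded_operator UNIV UNIV Y"
    using bounded_operator_diff[OF bounded_operator_compose[OF B X] bounded_operator_compose[OF X B]] by simp
  note Y = bounded_operatorD(2,3)[OF this UNIV_I] and Y_lin = bounded_operator_UNIV_imp_bounded_linear[OF this]
  have YF: "(Y ^^ k) v - c ^ k *\<^sub>C v \<in> F" for k
  proof (induction k)
    case 0
    then show ?case
      using closed_csubspaceD(2)[OF F(1)] by simp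
  next
    case (Suc k)
    have "(Y ^^ Suc k) v - c ^ Suc k *\<^sub>C v = Y ((Y ^^ k) v - c ^ k *\<^sub>C v) + c ^ k *\<^sub>C (Y v - c *\<^sub>C v)"
      using Y(2)[of "c ^ k" v] linear_diff[OF bounded_linear.linear[OF Y_lin]]
      by (simp add: complex_vector.scale_right_diff_distrib scaleC_scaleC mult.commute)
    then show ?case
      using closed_csubspaceD(3,4)[OF F(1)] F(2)[OF Suc.IH] Yv by metis
  qed
  define e where "e k = (1 / c ^ k) *\<^sub>C (Y ^^ k) v" for k
  have eF: "v - e k \<in> F" for k
  proof -
    have "v - e k = (- 1 / c ^ k) *\<^sub>C ((Y ^^ k) v - c ^ k *\<^sub>C v)"
      using \<open>c \<noteq> 0\<close> by (simp add: e_def complex_vector.scale_right_diff_distrib scaleC_scaleC)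
    then show ?thesis
      using closed_csubspaceD(4)[OF F(1) YF] by metis
  qed
  have e_le: "norm (e k) \<le> norm v * (inverse (fact k) * (K * L / cmod c) ^ k)" for k
  proof -
    have "fact k * norm ((Y ^^ k) v) = norm ((B ^^ k) ((X ^^ k) v))"
      unfolding commutator_power_eigenvector[OF lin XY BY v] by simp
    also have "\<dots> \<le> K ^ k * (L ^ k * norm v)"
      using K(2)[of k "(X ^^ k) v"] L(2)[of k v] K(1) by (meson mult_left_mono order_trans zero_le_power)
    finally have "norm ((Y ^^ k) v) \<le> K ^ k * (L ^ k * norm v) / fact k"
      by (simp add: field_simps)
    then have "norm (e k) \<le> (1 / cmod c ^ k) * (K ^ k * (L ^ k * norm v) / fact k)"
      unfolding e_def norm_scaleC norm_divide norm_power norm_one by (rule mult_left_mono) simp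
    then show ?thesis
      by (simp add: power_mult_distrib power_divide field_simps)
  qed
  have "(\<lambda>k. norm v * (inverse (fact k) * (K * L / cmod c) ^ k)) \<longlonglongrightarrow> norm v * 0"
    by (intro tendsto_intros summable_LIMSEQ_zero summable_exp)
  then have "e \<longlonglongrightarrow> 0"
    by (intro Lim_null_comparison[OF eventuallyI[OF e_le]]) simp
  then have "(\<lambda>k. v - e k) \<longlonglongrightarrow> v - 0"
    by (intro tendsto_intros)
  then show ?thesis
    using closed_sequentially[OF closed_csubspaceD(1)[OF F(1)]] eF by (metis diff_zero)
qed

section \<open>Operators with a flag structure\<close>

locale flag_operator =
  fixes \<Omega> :: "complex set" and n :: nat and H :: "nat \<Rightarrow> 'a::chilbert_space set"
    and T :: "'a \<Rightarrow> 'a" and A :: "nat \<Rightarrow> nat \<Rightarrow> 'a \<Rightarrow> 'a" and t :: "nat \<Rightarrow> complex \<Rightarrow> 'a"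
  assumes open_\<Omega>: "open \<Omega>" and connected_\<Omega>: "connected \<Omega>" and n_ge_2: "2 \<le> n"
    and FB: "FB_tilde n \<Omega> H T A"
    and nonvanishing: "nonvanishing_section \<Omega> (H (n - 1)) (A (n - 1) (n - 1)) (t (n - 1))"
    and recursion: "\<forall>i\<in>{1..n - 1}. \<forall>w\<in>\<Omega>. t (i - 1) w = A (i - 1) i (t i w)"
begin

lemma closed_csubspace_H: "i < n \<Longrightarrow> closed_csubspace (H i)"
  using FB by (simp add: FB_tilde_def orthogonal_direct_sum_def)

lemma cinner_H: "i < n \<Longrightarrow> j < n \<Longrightarrow> i \<noteq> j \<Longrightarrow> x \<in> H i \<Longrightarrow> y \<in> H j \<Longrightarrow> cinner x y = 0"
  using FB by (simp add: FB_tilde_def orthogonal_direct_sum_def)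

lemma bounded_operator_T: "bounded_operator UNIV UNIV T"
  using FB by (simp add: FB_tilde_def)

lemma cowen_douglas_A: "i < n \<Longrightarrow> cowen_douglas 1 \<Omega> (H i) (A i i)"
  using FB by (simp add: FB_tilde_def)

lemma A_nonzero: "Suc i < n \<Longrightarrow> \<exists>x\<in>H (Suc i). A i (Suc i) x \<noteq> 0"
  using FB by (simp add: FB_tilde_def)

lemma A_intertwines:
  "Suc i < n \<Longrightarrow> x \<in> H (Suc i) \<Longrightarrow> A i i (A i (Suc i) x) = A i (Suc i) (A (Suc i) (Suc i) x)"
  using FB by (simp add: FB_tilde_def)

lemma bounded_operator_A: "i < n \<Longrightarrow> j < n \<Longrightarrow> bounded_operator (H j) (H i) (A i j)"
  using FB by (simp add: FB_tilde_def has_block_matrix_def)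

lemma A_in: "i < n \<Longrightarrow> j < n \<Longrightarrow> x \<in> H j \<Longrightarrow> A i j x \<in> H i"
  using bounded_operatorD(1)[OF bounded_operator_A] by blast

definition P :: "nat \<Rightarrow> 'a \<Rightarrow> 'a" where "P i = cproj (H i)"

lemma bounded_operator_P: "i < n \<Longrightarrow> bounded_operator UNIV UNIV (P i)"
  unfolding P_def by (intro bounded_operator_range[OF bounded_operator_cproj] closed_csubspace_H)

lemma P_in: "i < n \<Longrightarrow> P i x \<in> H i"
  unfolding P_def by (intro cproj_in closed_csubspace_H)

lemma P_ident: "i < n \<Longrightarrow> x \<in> H i \<Longrightarrow> P i x = x"
  unfolding P_def by (intro cproj_ident closed_csubspace_H)

lemma P_eq_0: "i < n \<Longrightarrow> j < n \<Longrightarrow> i \<noteq> j \<Longrightarrow> x \<in> H j \<Longrightarrow> P i x = 0"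
  unfolding P_def
  by (rule cproj_eqI[OF closed_csubspace_H closed_csubspaceD(2)[OF closed_csubspace_H]])
    (simp_all add: cinner_H[of j i])

lemma cinner_P: "i < n \<Longrightarrow> y \<in> H i \<Longrightarrow> cinner (P i x) y = cinner x y"
  using cinner_diff_cproj[OF closed_csubspace_H, of i y x] by (simp add: P_def cinner_diff_left)

lemma sum_P: "(\<Sum>i<n. P i x) = x"
proof -
  have "\<exists>h. (\<forall>i<n. h i \<in> H i) \<and> x = (\<Sum>i<n. h i)"
    using FB by (simp add: FB_tilde_def orthogonal_direct_sum_def)
  then obtain h where h: "\<And>i. i < n \<Longrightarrow> h i \<in> H i" and x: "x = (\<Sum>i<n. h i)"
    by blast
  have "P i x = h i" if "i < n" for i
    unfolding P_def
  proof (rule cproj_eqI[OF closed_csubspace_H[OF that] h[OF that]])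
    fix y assume "y \<in> H i"
    then have "cinner x y = (\<Sum>j<n. if j = i then cinner (h i) y else 0)"
      unfolding x cinner_sum_left using h that by (intro sum.cong) (auto simp: cinner_H)
    then show "cinner (x - h i) y = 0"
      using that by (simp add: cinner_diff_left)
  qed
  then show ?thesis
    using x by simp
qed

lemma operator_eqI:
  assumes B: "bounded_operator UNIV UNIV B" and C: "bounded_operator UNIV UNIV C"
    and eq: "\<And>j x. j < n \<Longrightarrow> x \<in> H j \<Longrightarrow> B x = C x"
  shows "B x = C x"
proof -
  interpret B: bounded_linear B by (rule bounded_operator_UNIV_imp_bounded_linear[OF B])
  interpret C: bounded_linear C by (rule bounded_operator_UNIV_imp_bounded_linear[OF C])
  have "B (\<Sum>i<n. P i x) = C (\<Sum>i<n. P i x)"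
    unfolding B.sum C.sum by (intro sum.cong) (auto intro: eq P_in)
  then show ?thesis
    by (simp add: sum_P)
qed

lemma T_H:
  assumes j: "j < n" and x: "x \<in> H j"
  shows "T x = A j j x + (if j = 0 then 0 else A (j - 1) j x)"
proof -
  have "A i j x = 0" if "i < n" "j \<noteq> i" "j \<noteq> i + 1" for i
    using FB that j x by (simp add: FB_tilde_def)
  then have *: "A i j x = (if i = j then A j j x else 0) + (if i = j - 1 \<and> j \<noteq> 0 then A (j - 1) j x else 0)"
    if "i < n" for i
    using that by (cases j) auto
  have "T x = (\<Sum>i<n. A i j x)"
    using FB j x by (simp add: FB_tilde_def has_block_matrix_def)
  also have "\<dots> = (\<Sum>i<n. (if i = j then A j j x else 0) + (if i = j - 1 \<and> j \<noteq> 0 then A (j - 1) j x else 0))"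
    using * by (intro sum.cong) auto
  also have "\<dots> = A j j x + (if j = 0 then 0 else A (j - 1) j x)"
    unfolding sum.distrib using j by (cases j) auto
  finally show ?thesis .
qed

text \<open>The superdiagonal part \<open>S\<close> is the commutator of \<open>T\<close> with the grading operator \<open>G\<close>.\<close>

definition G :: "'a \<Rightarrow> 'a" where "G x = (\<Sum>i<n. of_nat i *\<^sub>C P i x)"

definition S :: "'a \<Rightarrow> 'a" where "S x = T (G x) - G (T x)"

lemma bounded_operator_G: "bounded_operator UNIV UNIV G"
  unfolding G_def[abs_def] by (intro bounded_operator_sum bounded_operator_scaleC bounded_operator_P) simp

lemma bounded_operator_S: "bounded_operator UNIV UNIV S"
  unfolding S_def[abs_def]
  by (intro bounded_operator_diff bounded_operator_compose[OF bounded_operator_T bounded_operator_G]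
      bounded_operator_compose[OF bounded_operator_G bounded_operator_T])

lemmas T_simps = bounded_operatorD(2,3)[OF bounded_operator_T UNIV_I]
lemmas G_simps = bounded_operatorD(2,3)[OF bounded_operator_G UNIV_I]
lemmas S_simps = bounded_operatorD(2,3)[OF bounded_operator_S UNIV_I]

sublocale S: bounded_linear S
  by (rule bounded_operator_UNIV_imp_bounded_linear[OF bounded_operator_S])

sublocale T: bounded_linear T
  by (rule bounded_operator_UNIV_imp_bounded_linear[OF bounded_operator_T])

lemma G_H:
  assumes "j < n" and "x \<in> H j" shows "G x = of_nat j *\<^sub>C x"
proof -
  have "G x = (\<Sum>i<n. if i = j then of_nat j *\<^sub>C x else 0)"
    unfolding G_def using assms P_eq_0[OF _ assms(1) _ assms(2)] P_ident[OF assms] by (intro sum.cong) auto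
  then show ?thesis
    using assms(1) by simp
qed

text \<open>\<open>G\<close> has weight j on the diagonal term and weight j - 1 on the superdiagonal
  one; in the commutator the former cancels and the latter survives with factor j - (j - 1) =
  1.\<close>

lemma S_H:
  assumes j: "j < n" and x: "x \<in> H j"
  shows "S x = (if j = 0 then 0 else A (j - 1) j x)"
proof (cases j)
  case 0
  then show ?thesis
    using G_H[OF j x] T_H[OF j x] G_H[OF j A_in[OF j j x]] T_simps(2)[of 0 x] by (simp add: S_def)
next
  case (Suc i)
  have "G (T x) = of_nat j *\<^sub>C A j j x + of_nat i *\<^sub>C A i j x"
    using T_H[OF j x] G_H[OF j A_in[OF j j x]] G_H[of i, OF _ A_in[OF _ j x]] Suc j
    by (simp add: G_simps)
  moreover have "T (G x) = of_nat j *\<^sub>C A j j x + of_nat j *\<^sub>C A i j x"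
    using T_H[OF j x] Suc by (simp add: G_H[OF j x] T_simps(2) scaleC_add_right)
  moreover have "of_nat j *\<^sub>C A i j x = of_nat i *\<^sub>C A i j x + A i j x"
    using Suc by (simp add: scaleC_add_left)
  ultimately show ?thesis
    using Suc by (simp add: S_def)
qed

lemma S_in: "Suc i < n \<Longrightarrow> x \<in> H (Suc i) \<Longrightarrow> S x \<in> H i"
  using S_H[of "Suc i" x] A_in[of i "Suc i" x] by simp

lemma T_H_S: "j < n \<Longrightarrow> x \<in> H j \<Longrightarrow> T x = A j j x + S x"
  using T_H S_H by simp

text \<open>On each summand \<open>T\<close> is its diagonal entry plus \<open>S\<close>; the
  diagonal part commutes with \<open>S\<close> by the intertwining relations
  \<open>A_intertwines\<close>.\<close>

lemma T_S: "T (S x) = S (T x)"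
proof (rule operator_eqI[where B = "\<lambda>x. T (S x)" and C = "\<lambda>x. S (T x)"])
  fix j x assume j: "j < n" and x: "x \<in> H j"
  show "T (S x) = S (T x)"
  proof (cases j)
    case 0
    then show ?thesis
      using S_H[OF j x] T_H[OF j x] S_H[OF j A_in[OF j j x]] by (simp add: T.zero)
  next
    case (Suc i)
    then have i: "i < n" "Suc i < n"
      using j by auto
    have Sx: "S x = A i j x"
      using S_H[OF j x] Suc by simp
    have "T (S x) = A i i (A i j x) + S (S x)"
      using T_H_S[OF i(1)] A_in[OF i(1) j x] by (simp add: Sx)
    also have "A i i (A i j x) = A i j (A j j x)"
      using A_intertwines[OF i(2), of x] x Suc by simp
    also have "\<dots> = S (A j j x)"
      using S_H[OF j A_in[OF j j x]] Suc by simp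
    finally show ?thesis
      using T_H_S[OF j x] by (simp add: S.add)
  qed
qed (intro bounded_operator_compose[OF bounded_operator_T bounded_operator_S]
  bounded_operator_compose[OF bounded_operator_S bounded_operator_T])+

lemma T_S_funpow: "T ((S ^^ k) x) = (S ^^ k) (T x)"
  by (induction k) (simp_all add: T_S)

text \<open>The flag H_0 + ... + H_(j-1), written as the orthogonal complement of the remaining
  summands, so that closedness is immediate. It is {0} for j = 0 and the whole space for j =
  n.\<close>

definition F :: "nat \<Rightarrow> 'a set" where "F j = {x. \<forall>y\<in>(\<Union>i\<in>{j..<n}. H i). cinner x y = 0}"

lemma closed_csubspace_F: "closed_csubspace (F j)"
  unfolding F_def by (rule closed_csubspace_orthogonal)

lemmas F_closed = closed_csubspaceD(2-)[OF closed_csubspace_F]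

lemma mem_F_iff: "x \<in> F j \<longleftrightarrow> (\<forall>i. j \<le> i \<longrightarrow> i < n \<longrightarrow> P i x = 0)"
proof -
  have "P i x = 0 \<longleftrightarrow> (\<forall>y\<in>H i. cinner x y = 0)" if "i < n" for i
  proof
    assume "P i x = 0"
    then show "\<forall>y\<in>H i. cinner x y = 0"
      using cinner_P[OF that, of _ x] by simp
  next
    assume "\<forall>y\<in>H i. cinner x y = 0"
    then show "P i x = 0"
      using cinner_P[OF that P_in[OF that], of x x] P_in[OF that, of x] by simp
  qed
  then show ?thesis
    unfolding F_def by auto
qed

lemma cinner_F_H: "x \<in> F j \<Longrightarrow> y \<in> H j \<Longrightarrow> j < n \<Longrightarrow> cinner x y = 0"
  unfolding F_def by auto

lemma H_subset_F: "x \<in> H i \<Longrightarrow> i < j \<Longrightarrow> i < n \<Longrightarrow> x \<in> F j"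
  using P_eq_0 by (auto simp: mem_F_iff)

lemma F_mono: "i \<le> j \<Longrightarrow> F i \<subseteq> F j"
  by (auto simp: mem_F_iff)

lemma F_0: "x \<in> F 0 \<longleftrightarrow> x = 0"
proof
  assume "x \<in> F 0"
  then have "(\<Sum>i<n. P i x) = 0"
    by (simp add: mem_F_iff)
  then show "x = 0"
    by (simp add: sum_P)
qed (simp add: F_closed)

lemma F_diff_P: "x \<in> F (Suc j) \<Longrightarrow> j < n \<Longrightarrow> x - P j x \<in> F j"
proof -
  assume x: "x \<in> F (Suc j)" and j: "j < n"
  have "P i (x - P j x) = 0" if "j \<le> i" "i < n" for i
  proof (cases "i = j")
    case True
    then show ?thesis
      using linear_diff[OF bounded_linear.linear[OF bounded_operator_UNIV_imp_bounded_linear[OF bounded_operator_P[OF j]]]]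
        P_ident[OF j P_in[OF j]] by simp
  next
    case False
    then show ?thesis
      using linear_diff[OF bounded_linear.linear[OF bounded_operator_UNIV_imp_bounded_linear[OF bounded_operator_P[OF that(2)]]]]
        P_eq_0[OF that(2) j False P_in[OF j]] x that by (simp add: mem_F_iff)
  qed
  then show ?thesis
    by (simp add: mem_F_iff)
qed

text \<open>\<open>H j\<close> is the orthogonal complement of \<open>F j\<close> in
  \<open>F (Suc j)\<close>. Thus a unitary that preserves the flag preserves the summands.\<close>

lemma mem_HI:
  assumes x: "x \<in> F (Suc j)" and orth: "\<And>y. y \<in> F j \<Longrightarrow> cinner x y = 0" and j: "j < n"
  shows "x \<in> H j"
proof -
  have "cinner (x - P j x) (x - P j x) = 0"
  proof -
    have F: "x - P j x \<in> F j"
      by (rule F_diff_P[OF x j])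
    have "cinner (P j x) (x - P j x) = 0"
      using cinner_F_H[OF F P_in[OF j] j, of x] cinner_eq_zero_commute by blast
    then show ?thesis
      using orth[OF F] by (simp add: cinner_diff_left)
  qed
  then show ?thesis
    using P_in[OF j, of x] by simp
qed

text \<open>Peels off the highest component \<open>P j x\<close> first, so that the remainder lies
  in a lower member of the flag.\<close>

lemma F_induct [consumes 2, case_names zero step]:
  assumes "x \<in> F j" and "j \<le> n" and "Q 0"
    and "\<And>i y z. i < j \<Longrightarrow> y \<in> H i \<Longrightarrow> z \<in> F i \<Longrightarrow> Q z \<Longrightarrow> Q (y + z)"
  shows "Q x"
  using assms(1,2,4)
proof (induction j arbitrary: x)
  case 0
  then show ?case
    using assms(3) by (simp add: F_0)
next
  case (Suc j)
  have j: "j < n"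
    using Suc.prems by simp
  have F: "x - P j x \<in> F j"
    by (rule F_diff_P[OF Suc.prems(1) j])
  have Q: "Q (x - P j x)"
  proof (rule Suc.IH[OF F])
    show "Q (y + z)" if "i < j" "y \<in> H i" "z \<in> F i" "Q z" for i y z
      using Suc.prems(3)[OF _ that(2-4)] that(1) by simp
  qed (use j in simp)
  have "Q (P j x + (x - P j x))"
    by (rule Suc.prems(3)[OF lessI P_in[OF j] F Q])
  then show ?case
    by (simp add: add_diff_eq)
qed

lemma S_F:
  assumes "x \<in> F (Suc j)" and "Suc j \<le> n" shows "S x \<in> F j"
  using assms
proof (induction rule: F_induct)
  case (step i y z)
  have "S y \<in> F j"
  proof (cases i)
    case 0
    then show ?thesis
      using step S_H[of 0 y] F_closed(1) n_ge_2 by simp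
  next
    case (Suc k)
    then show ?thesis
      using H_subset_F[OF S_in[of k y], of j] step assms(2) by auto
  qed
  then show ?case
    using step F_closed(2) by (simp add: S.add)
qed (simp add: S.zero F_closed)

lemma S_F_subset: "x \<in> F j \<Longrightarrow> j \<le> n \<Longrightarrow> S x \<in> F j"
proof (cases j)
  case 0
  then show "x \<in> F j \<Longrightarrow> j \<le> n \<Longrightarrow> S x \<in> F j"
    by (simp add: F_0 S.zero)
next
  case (Suc i)
  then show "x \<in> F j \<Longrightarrow> j \<le> n \<Longrightarrow> S x \<in> F j"
    using S_F F_mono[of i j] by auto
qed

lemma S_funpow_F_subset: "x \<in> F j \<Longrightarrow> j \<le> n \<Longrightarrow> (S ^^ k) x \<in> F j"
  by (induction k) (simp_all add: S_F_subset)

lemma S_funpow_F: "x \<in> F (j + k) \<Longrightarrow> j + k \<le> n \<Longrightarrow> (S ^^ k) x \<in> F j"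
  by (induction k arbitrary: x) (simp_all add: S_F funpow_swap1)

section \<open>The sections t_i and their totality\<close>

lemma section_t: "i < n \<Longrightarrow> holomorphic_section \<Omega> (H i) (A i i) (t i)"
proof -
  assume "i < n"
  then have "i \<le> n - 1"
    by simp
  then show ?thesis
  proof (induction i rule: inc_induct)
    case base
    then show ?case
      using nonvanishing by (simp add: nonvanishing_section_def)
  next
    case (step i)
    then have i: "Suc i < n" "i < n"
      by auto
    note tS = holomorphic_sectionD[OF step.IH]
    have eq: "t i w = A i (Suc i) (t (Suc i) w)" "t i w = S (t (Suc i) w)" if "w \<in> \<Omega>" for w
    proof -
      show "t i w = A i (Suc i) (t (Suc i) w)"
        using recursion[rule_format, of "Suc i" w] i that by simp
      then show "t i w = S (t (Suc i) w)"
        using S_H[OF i(1) tS(2)[OF that]] by simp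
    qed
    \<comment> \<open>The intertwining relation carries the eigenvalue w from
      \<open>t (Suc i) w\<close> to its image.\<close>
    have "A i i (t i w) = w *\<^sub>C t i w" if "w \<in> \<Omega>" for w
    proof -
      have "A i i (A i (Suc i) (t (Suc i) w)) = A i (Suc i) (A (Suc i) (Suc i) (t (Suc i) w))"
        by (rule A_intertwines[OF i(1) tS(2)[OF that]])
      then show ?thesis
        using tS(3)[OF that] bounded_operatorD(3)[OF bounded_operator_A[OF i(2,1)] tS(2)[OF that], of w]
        by (simp add: eq(1)[OF that])
    qed
    moreover have "t i w \<in> H i" if "w \<in> \<Omega>" for w
      using S_in[OF i(1) tS(2)[OF that]] eq(2)[OF that] by simp
    moreover have "\<exists>d. (t i has_derivative (\<lambda>h. h *\<^sub>C d)) (at w)" if "w \<in> \<Omega>" for w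
      using has_derivative_transform_within_open[OF
          has_derivative_vderiv[OF vholomorphic_on_bounded_operator[OF bounded_operator_S tS(1)] that]
          open_\<Omega> that, of "t i"] eq(2) by auto
    ultimately show ?case
      by (simp add: holomorphic_section_def eigenspace_def)
  qed
qed

lemmas t_vholomorphic = holomorphic_sectionD(1)[OF section_t]
lemmas t_in = holomorphic_sectionD(2)[OF section_t]
lemmas A_t = holomorphic_sectionD(3)[OF section_t]

lemma S_t: "Suc i < n \<Longrightarrow> w \<in> \<Omega> \<Longrightarrow> S (t (Suc i) w) = t i w"
  using S_H[OF _ t_in, of "Suc i" w] recursion[rule_format, of "Suc i" w] by simp

lemma S_t_0: "w \<in> \<Omega> \<Longrightarrow> S (t 0 w) = 0"
  using S_H[OF _ t_in, of 0 w] n_ge_2 by simp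

lemma T_t: "i < n \<Longrightarrow> w \<in> \<Omega> \<Longrightarrow> T (t i w) = w *\<^sub>C t i w + S (t i w)"
  using T_H_S[OF _ t_in] A_t by simp

lemma S_funpow_t: "j + k < n \<Longrightarrow> w \<in> \<Omega> \<Longrightarrow> (S ^^ k) (t (j + k) w) = t j w"
  by (induction k) (simp_all add: S_t funpow_swap1)

text \<open>\<open>t j w\<close> is the image of \<open>t i w\<close> under a power of
  \<open>S\<close>, so zeros propagate to lower indices.\<close>

lemma t_nonzero_mono:
  assumes "t j w \<noteq> 0" and "j \<le> i" and "i < n" and "w \<in> \<Omega>" shows "t i w \<noteq> 0"
proof
  assume "t i w = 0"
  moreover have "(S ^^ k) 0 = 0" for k
    by (induction k) (simp_all add: S.zero)
  ultimately show False
    using assms S_funpow_t[of j "i - j" w] by simp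
qed

lemma t_nonvanishing: "w \<in> \<Omega> \<Longrightarrow> t (n - 1) w \<noteq> 0"
  using nonvanishing by (simp add: nonvanishing_section_def)

text \<open>The empty set counts as connected, so this must be derived: over it the eigenvectors
  span only {0}, which leaves no room for a non-zero superdiagonal entry.\<close>

lemma \<Omega>_nonempty: "\<Omega> \<noteq> {}"
proof
  assume "\<Omega> = {}"
  have "cowen_douglas 1 \<Omega> (H 1) (A 1 1)"
    using n_ge_2 by (intro cowen_douglas_A) simp
  then have "H 1 = {0}"
    using \<open>\<Omega> = {}\<close> by (simp add: cowen_douglas_def complex_vector.span_empty)
  moreover have "A 0 1 0 = 0"
    using bounded_operatorD(3)[OF bounded_operator_A[of 0 1], of 0 0] n_ge_2 calculation by simp
  ultimately show False
    using A_nonzero[of 0] n_ge_2 by simp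
qed

lemma closed_csubspace_singleton_0: "closed_csubspace {0 :: 'a}"
  by (rule closed_csubspaceI) auto

text \<open>If \<open>t i\<close> vanished identically, \<open>S\<close> would kill the values of
  \<open>t (Suc i)\<close>, which are total in \<open>H (Suc i)\<close>, contradicting that the
  superdiagonal entry is non-zero.\<close>

lemma t_not_identically_0: "i < n \<Longrightarrow> \<exists>w\<in>\<Omega>. t i w \<noteq> 0"
proof -
  assume "i < n"
  then have "i \<le> n - 1"
    by simp
  then show ?thesis
  proof (induction i rule: inc_induct)
    case base
    then show ?case
      using \<Omega>_nonempty t_nonvanishing by blast
  next
    case (step i)
    then have i: "Suc i < n" "i < n"
      by auto
    obtain w\<^sub>1 where w\<^sub>1: "w\<^sub>1 \<in> \<Omega>" "t (Suc i) w\<^sub>1 \<noteq> 0"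
      using step.IH by blast
    show ?case
    proof (rule ccontr)
      assume "\<not> ?thesis"
      then have "H (Suc i) \<subseteq> S -` {0}"
        using S_t[OF i(1)]
        by (intro section_total[OF cowen_douglas_A[OF i(1)] open_\<Omega> connected_\<Omega> section_t[OF i(1)] w\<^sub>1
              open_\<Omega> \<Omega>_nonempty subset_refl closed_csubspace_vimage[OF bounded_operator_S closed_csubspace_singleton_0]])
          simp
      then have "A i (Suc i) x = 0" if "x \<in> H (Suc i)" for x
        using S_H[OF i(1) that] that by auto
      then show False
        using A_nonzero[OF i(1)] by blast
    qed
  qed
qed

lemma t_total:
  assumes i: "i < n" and D: "open D" "D \<noteq> {}" "D \<subseteq> \<Omega>" and N: "closed_csubspace N"
    and tN: "\<And>w. w \<in> D \<Longrightarrow> t i w \<in> N"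
  shows "H i \<subseteq> N"
proof -
  obtain w\<^sub>1 where w\<^sub>1: "w\<^sub>1 \<in> \<Omega>" "t i w\<^sub>1 \<noteq> 0"
    using t_not_identically_0[OF i] by blast
  show ?thesis
    by (rule section_total[OF cowen_douglas_A[OF i] open_\<Omega> connected_\<Omega> section_t[OF i] w\<^sub>1 D N tN])
qed

text \<open>\<open>t i w\<close> sees only the component \<open>P i x\<close>, so each component is
  tested separately.\<close>

lemma eq_0_if_cinner_t:
  assumes D: "open D" "D \<noteq> {}" "D \<subseteq> \<Omega>"
    and orth: "\<And>i w. i < n \<Longrightarrow> w \<in> D \<Longrightarrow> cinner (t i w) x = 0"
  shows "x = 0"
proof -
  have "P i x = 0" if i: "i < n" for i
  proof -
    obtain w\<^sub>1 where w\<^sub>1: "w\<^sub>1 \<in> \<Omega>" "t i w\<^sub>1 \<noteq> 0"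
      using t_not_identically_0[OF i] by blast
    show ?thesis
    proof (rule section_orthogonal[OF cowen_douglas_A[OF i] open_\<Omega> connected_\<Omega> section_t[OF i] w\<^sub>1 D P_in[OF i]])
      fix w assume w: "w \<in> D"
      then have "cinner (P i x) (t i w) = 0"
        using cinner_P[OF i t_in[OF i], of w x] orth[OF i w] D(3) cinner_eq_zero_commute by fastforce
      then show "cinner (t i w) (P i x) = 0"
        using cinner_eq_zero_commute by blast
    qed
  qed
  then have "(\<Sum>i<n. P i x) = 0"
    by simp
  then show ?thesis
    by (simp add: sum_P)
qed

text \<open>On \<open>F j\<close> the operator T - w is block triangular with surjective diagonal
  entries: solve for the top component, then correct the error, which lies one step lower in the
  flag.\<close>

lemma T_surj_on_F:
  assumes w: "w \<in> \<Omega>" and "y \<in> F j" and "j \<le> n"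
  obtains x where "x \<in> F j" and "T x - w *\<^sub>C x = y"
proof -
  have "\<exists>x\<in>F j. T x - w *\<^sub>C x = y"
    using assms(2,3)
  proof (induction j arbitrary: y)
    case 0
    then show ?case
      by (auto simp: F_0 T.zero)
  next
    case (Suc j)
    then have j: "j < n"
      by simp
    have "(\<lambda>x. A j j x - w *\<^sub>C x) ` H j = H j"
      using cowen_douglas_A[OF j] w by (simp add: cowen_douglas_def)
    then obtain h where h: "h \<in> H j" "A j j h - w *\<^sub>C h = P j y"
      using P_in[OF j, of y] by (metis (no_types, lifting) imageE)
    have hF: "h \<in> F (Suc j)"
      using H_subset_F h(1) j by simp
    have "y - P j y - S h \<in> F j"
      by (intro F_closed F_diff_P S_F hF Suc.prems j)
    then obtain x where x: "x \<in> F j" "T x - w *\<^sub>C x = y - P j y - S h"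
      using Suc by auto
    have "T (x + h) - w *\<^sub>C (x + h) = y"
      using x(2) h(2) T_H_S[OF j h(1)] by (simp add: T.add scaleC_add_right algebra_simps)
    moreover have "x + h \<in> F (Suc j)"
      using F_mono[of j "Suc j"] x(1) by (intro F_closed hF) auto
    ultimately show ?case
      by blast
  qed
  then show ?thesis
    using that by blast
qed

text \<open>\<open>t j w\<close> fails to be an eigenvector of \<open>T\<close> only by
  \<open>S (t j w)\<close>, which lies in \<open>F j\<close> and can be removed there by
  \<open>T_surj_on_F\<close>.\<close>

lemma eigenvector_over_t:
  assumes w: "w \<in> \<Omega>" and j: "j < n"
  obtains \<gamma> where "T \<gamma> = w *\<^sub>C \<gamma>" and "\<gamma> - t j w \<in> F j"
proof -
  have "- S (t j w) \<in> F j"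
    using H_subset_F[OF t_in[OF j w], of "Suc j"] j by (intro F_closed S_F) auto
  then obtain x where x: "x \<in> F j" "T x - w *\<^sub>C x = - S (t j w)"
    using T_surj_on_F[OF w _ less_imp_le[OF j]] by metis
  then have "T (t j w + x) = w *\<^sub>C (t j w + x)"
    using T_t[OF j w] by (simp add: T.add scaleC_add_right algebra_simps)
  then show ?thesis
    using that[of "t j w + x"] x(1) by simp
qed

text \<open>The highest non-zero component of x, at some index l \<ge> j, is an eigenvector of the
  diagonal entry and hence a multiple of \<open>t l w\<close>. Applying \<open>S\<close> l - j times
  moves it to \<open>t j w\<close> and everything below it into \<open>F j\<close>.\<close>

lemma eigenvector_lowered:
  assumes w: "w \<in> \<Omega>" "t 0 w \<noteq> 0" and x: "T x = w *\<^sub>C x" "x \<notin> F j" and j: "j < n"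
  obtains k a where "a \<noteq> 0" and "(S ^^ k) x - a *\<^sub>C t j w \<in> F j"
proof -
  define l where "l = (GREATEST l. l < n \<and> P l x \<noteq> 0)"
  obtain i where i: "j \<le> i" "i < n \<and> P i x \<noteq> 0"
    using x(2) by (auto simp: mem_F_iff)
  have bound: "\<And>y. y < n \<and> P y x \<noteq> 0 \<Longrightarrow> y \<le> n"
    by simp
  have l: "l < n" "P l x \<noteq> 0"
    using GreatestI_nat[where P = "\<lambda>l. l < n \<and> P l x \<noteq> 0", OF i(2) bound] by (simp_all add: l_def)
  have le_l: "m \<le> l" if "m < n \<and> P m x \<noteq> 0" for m
    unfolding l_def by (rule Greatest_le_nat[where P = "\<lambda>l. l < n \<and> P l x \<noteq> 0", OF that bound])
  have "j \<le> l"
    using le_l[OF i(2)] i(1) by simp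
  have above: "P m x = 0" if "l < m" "m < n" for m
    using le_l[of m] that by auto
  have xF: "x \<in> F (Suc l)"
    using above by (simp add: mem_F_iff)
  interpret Pl: bounded_linear "P l"
    by (rule bounded_operator_UNIV_imp_bounded_linear[OF bounded_operator_P[OF l(1)]])
  define r where "r = x - P l x"
  have r: "r \<in> F l"
    unfolding r_def by (rule F_diff_P[OF xF l(1)])
  have PF: "P l y = 0" if "y \<in> F l" for y
    using that l(1) by (simp add: mem_F_iff)
  \<comment> \<open>\<open>T\<close> is upper triangular, so the lower components r contribute
    nothing to the l-th component of \<open>T x\<close>.\<close>
  have "T r \<in> F l" if "r \<in> F l" for r
    using that less_imp_le[OF l(1)]
  proof (induction rule: F_induct)
    case (step i y z)
    then have "T y = A i i y + S y" "A i i y \<in> F l" "S y \<in> F l"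
      using T_H_S[of i y] H_subset_F[OF A_in[of i i y], of l] H_subset_F[of y i l] l(1) S_F_subset[of y l]
      by auto
    then show ?case
      using step F_closed(2) by (simp add: T.add)
  qed (simp add: T.zero F_closed)
  then have "P l (T r) = 0"
    using PF r by blast
  moreover have "T x = A l l (P l x) + S (P l x) + T r"
    using T_H_S[OF l(1) P_in[OF l(1)], of x] by (simp add: r_def T.diff)
  moreover have "S (P l x) \<in> F l"
    using H_subset_F[OF P_in[OF l(1)], of "Suc l" x] l(1) by (intro S_F) auto
  ultimately have "P l (T x) = A l l (P l x)"
    using PF P_ident[OF l(1) A_in[OF l(1) l(1) P_in[OF l(1)]]] by (simp add: Pl.add)
  then have "A l l (P l x) = w *\<^sub>C P l x"
    using x(1) bounded_operatorD(3)[OF bounded_operator_P[OF l(1)]] by simp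
  then have "P l x \<in> eigenspace (H l) (A l l) w" "t l w \<in> eigenspace (H l) (A l l) w"
    using P_in[OF l(1)] t_in[OF l(1) w(1)] A_t[OF l(1) w(1)] by (simp_all add: eigenspace_def)
  then obtain a where a: "P l x = a *\<^sub>C t l w"
    using eigenspace_multiple[OF cowen_douglas_A[OF l(1)] w(1)] t_nonzero_mono[OF w(2) _ l(1) w(1)]
    by (metis le0)
  have "a \<noteq> 0"
    using l(2) a by auto
  moreover have "(S ^^ (l - j)) x - a *\<^sub>C t j w \<in> F j"
  proof -
    have "(S ^^ (l - j)) r \<in> F j"
      using S_funpow_F[of r j "l - j"] r l(1) \<open>j \<le> l\<close> by simp
    moreover have "(S ^^ (l - j)) x = (S ^^ (l - j)) (a *\<^sub>C t l w + r)"
      by (simp add: r_def flip: a)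
    moreover have "\<dots> = a *\<^sub>C (S ^^ (l - j)) (t l w) + (S ^^ (l - j)) r"
      using bounded_operatorD(2,3)[OF bounded_operator_funpow[OF bounded_operator_S] UNIV_I] by simp
    ultimately show ?thesis
      using S_funpow_t[of j "l - j" w] l(1) \<open>j \<le> l\<close> w(1) by simp
  qed
  ultimately show ?thesis
    using that by blast
qed

lemma t_notin_F: "i < n \<Longrightarrow> w \<in> \<Omega> \<Longrightarrow> t i w \<noteq> 0 \<Longrightarrow> t i w \<notin> F i"
  using P_ident[OF _ t_in] by (auto simp: mem_F_iff)

end

section \<open>Curvature in terms of an arbitrary section; inverses of unitaries\<close>

lemma nonvanishing_sectionD:
  assumes "nonvanishing_section \<Omega> M T \<gamma>"
  shows "\<gamma> vholomorphic_on \<Omega>" and "w \<in> \<Omega> \<Longrightarrow> \<gamma> w \<in> eigenspace M T w" and "w \<in> \<Omega> \<Longrightarrow> \<gamma> w \<noteq> 0"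
  using assms
  by (auto simp: nonvanishing_section_def holomorphic_section_def vholomorphic_on_def)

text \<open>The section chosen in \<open>curvature\<close> and the given one differ by a
  non-vanishing holomorphic factor, because the eigenspaces are lines.\<close>

lemma curvature_eq:
  assumes T: "cowen_douglas 1 \<Omega> M T" and \<Omega>: "open \<Omega>" and \<gamma>: "nonvanishing_section \<Omega> M T \<gamma>"
    and w: "w \<in> \<Omega>"
  shows "curvature \<Omega> M T w = - d_w (d_wbar (\<lambda>z. complex_of_real (ln ((norm (\<gamma> z))\<^sup>2)))) w"
proof -
  define \<gamma>\<^sub>0 where "\<gamma>\<^sub>0 = (SOME \<gamma>. nonvanishing_section \<Omega> M T \<gamma>)"
  have \<gamma>\<^sub>0: "nonvanishing_section \<Omega> M T \<gamma>\<^sub>0"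
    unfolding \<gamma>\<^sub>0_def by (rule someI[where P = "nonvanishing_section \<Omega> M T", OF \<gamma>])
  note d = nonvanishing_sectionD[OF \<gamma>] and d\<^sub>0 = nonvanishing_sectionD[OF \<gamma>\<^sub>0]
  have "\<forall>z\<in>\<Omega>. \<exists>c. \<gamma>\<^sub>0 z = c *\<^sub>C \<gamma> z"
    using eigenspace_multiple[OF T _ d(2) d(3) d\<^sub>0(2)] by blast
  then obtain \<phi> where \<phi>: "\<And>z. z \<in> \<Omega> \<Longrightarrow> \<gamma>\<^sub>0 z = \<phi> z *\<^sub>C \<gamma> z"
    by metis
  have "\<phi> holomorphic_on \<Omega>"
    by (rule holomorphic_on_scaleC_ratio[OF d\<^sub>0(1) d(1) \<Omega> d(3) \<phi>])
  moreover have "\<phi> z \<noteq> 0" if "z \<in> \<Omega>" for z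
    using \<phi>[OF that] d\<^sub>0(3)[OF that] by auto
  ultimately have "d_wbar (log_grad \<gamma>\<^sub>0) w = d_wbar (log_grad \<gamma>) w"
    by (intro d_wbar_log_grad_scaleC[OF _ d(1) \<Omega> w _ d(3) \<phi>])
  then show ?thesis
    using laplace_ln_norm[OF d\<^sub>0(1) \<Omega> w d\<^sub>0(3)] laplace_ln_norm[OF d(1) \<Omega> w d(3)]
    by (simp add: curvature_def Let_def \<gamma>\<^sub>0_def[symmetric])
qed

lemma unitary_inverse:
  fixes U :: "'a::chilbert_space \<Rightarrow> 'b::chilbert_space"
  assumes U: "unitary U"
  obtains V where "bounded_operator UNIV UNIV V" and "\<And>y. U (V y) = y" and "\<And>x. V (U x) = x"
proof -
  have lin: "bounded_linear U"
    using U bounded_operator_UNIV_imp_bounded_linear by (auto simp: unitary_def)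
  have norm_U: "norm (U x) = norm x" for x
    using U by (intro norm_eq_if_cinner_eq) (simp add: unitary_def)
  have inj: "x = y" if "U x = U y" for x y
  proof -
    have "norm (x - y) = norm (U x - U y)"
      using norm_U[of "x - y"] linear_diff[OF bounded_linear.linear[OF lin]] by simp
    then show ?thesis
      using that by simp
  qed
  obtain V where V: "\<And>y. U (V y) = y"
    using U unfolding unitary_def surj_def by metis
  have "U (x + y) = U x + U y" "U (c *\<^sub>C x) = c *\<^sub>C U x" for x y c
    using U bounded_operatorD(2,3)[of UNIV UNIV U] by (auto simp: unitary_def)
  then have "V (x + y) = V x + V y" "V (c *\<^sub>C x) = c *\<^sub>C V x" for x y c
    by (auto intro: inj simp: V)
  moreover have "norm (V y) \<le> 1 * norm y" for y
    using norm_U[of "V y"] by (simp add: V)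
  ultimately have "bounded_operator UNIV UNIV V"
    unfolding bounded_operator_def by (auto intro: exI[of _ 1])
  then show ?thesis
    using that V inj by metis
qed

section \<open>Pairs of operators\<close>

locale flag_operators =
  X: flag_operator \<Omega> n H T A t + Y: flag_operator \<Omega> n H' T' A' t'
  for \<Omega> :: "complex set" and n :: nat
    and H :: "nat \<Rightarrow> 'a::chilbert_space set" and H' :: "nat \<Rightarrow> 'b::chilbert_space set"
    and T :: "'a \<Rightarrow> 'a" and T' :: "'b \<Rightarrow> 'b"
    and A :: "nat \<Rightarrow> nat \<Rightarrow> 'a \<Rightarrow> 'a" and A' :: "nat \<Rightarrow> nat \<Rightarrow> 'b \<Rightarrow> 'b"
    and t :: "nat \<Rightarrow> complex \<Rightarrow> 'a" and t' :: "nat \<Rightarrow> complex \<Rightarrow> 'b"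
begin

abbreviation curvatures_eq :: bool where
  "curvatures_eq \<equiv> (\<forall>w\<in>\<Omega>. curvature \<Omega> (H (n - 1)) (A (n - 1) (n - 1)) w
            = curvature \<Omega> (H' (n - 1)) (A' (n - 1) (n - 1)) w)"

abbreviation ratios_eq :: bool where
  "ratios_eq \<equiv> (\<forall>i\<in>{1..n - 1}. \<forall>w\<in>\<Omega>. t i w \<noteq> 0 \<and> t' i w \<noteq> 0 \<longrightarrow>
        norm (t (i - 1) w) / norm (t i w) = norm (t' (i - 1) w) / norm (t' i w))"

section \<open>Sufficiency of the curvature and ratio conditions\<close>

lemma last_lt: "n - 1 < n"
  using X.n_ge_2 by simp

text \<open>The ratio condition is silent where \<open>t (Suc i) w\<close> or
  \<open>t' (Suc i) w\<close> is zero; but by induction both then vanish, and so do their images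
  under the superdiagonal operators.\<close>

lemma norm_t_eq:
  assumes "ratios_eq" and w: "w \<in> \<Omega>" and top: "norm (t (n - 1) w) = c * norm (t' (n - 1) w)"
    and "c \<noteq> 0" and "i < n"
  shows "norm (t i w) = c * norm (t' i w)"
proof -
  have "i \<le> n - 1"
    using \<open>i < n\<close> by simp
  then show ?thesis
  proof (induction i rule: inc_induct)
    case base
    show ?case
      by (rule top)
  next
    case (step i)
    then have i: "Suc i < n"
      by auto
    show ?case
    proof (cases "t (Suc i) w = 0")
      case True
      then have "t' (Suc i) w = 0"
        using step.IH \<open>c \<noteq> 0\<close> by simp
      then show ?thesis
        using True X.S_t[OF i w] Y.S_t[OF i w] by (simp add: X.S.zero Y.S.zero)
    next
      case False
      then have "t' (Suc i) w \<noteq> 0"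
        using step.IH by auto
      then have "norm (t i w) / norm (t (Suc i) w) = norm (t' i w) / norm (t' (Suc i) w)"
        using assms(1)[rule_format, of "Suc i" w] False i w by simp
      then show ?thesis
        using step.IH False \<open>t' (Suc i) w \<noteq> 0\<close> \<open>c \<noteq> 0\<close> by (simp add: field_simps)
    qed
  qed
qed

lemma unitarily_equivalent_if:
  assumes curv: "curvatures_eq" and ratio: "ratios_eq"
  shows "unitarily_equivalent T T'"
proof -
  obtain w\<^sub>0 where "w\<^sub>0 \<in> \<Omega>"
    using X.\<Omega>_nonempty by blast
  then obtain r where r: "0 < r" "ball w\<^sub>0 r \<subseteq> \<Omega>"
    using X.open_\<Omega> open_contains_ball by blast
  \<comment> \<open>\<open>cinner_eq_if_norm_eq\<close> polarises only on the disc of half the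
    radius.\<close>
  define D where "D = ball w\<^sub>0 (r / 2)"
  have D: "open D" "D \<noteq> {}" "D \<subseteq> \<Omega>"
    using r by (auto simp: D_def)
  have D_r: "D \<subseteq> ball w\<^sub>0 r"
    using r(1) by (auto simp: D_def)
  note d = nonvanishing_sectionD[OF X.nonvanishing] and d' = nonvanishing_sectionD[OF Y.nonvanishing]
  obtain \<phi> where \<phi>: "\<phi> holomorphic_on ball w\<^sub>0 r" "\<And>z. \<phi> z \<noteq> 0"
    "\<And>z. z \<in> ball w\<^sub>0 r \<Longrightarrow> norm (t (n - 1) z) = cmod (\<phi> z) * norm (t' (n - 1) z)"
  proof (rule norm_ratio_holomorphic)
    show "t (n - 1) vholomorphic_on ball w\<^sub>0 r" "t' (n - 1) vholomorphic_on ball w\<^sub>0 r"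
      using vholomorphic_on_subset r(2) d(1) d'(1) by blast+
    show "d_wbar (log_grad (t (n - 1))) z = d_wbar (log_grad (t' (n - 1))) z" if "z \<in> ball w\<^sub>0 r" for z
    proof -
      have z: "z \<in> \<Omega>"
        using that r(2) by blast
      show ?thesis
        using curv[rule_format, OF z]
          curvature_eq[OF X.cowen_douglas_A[OF last_lt] X.open_\<Omega> X.nonvanishing z]
          curvature_eq[OF Y.cowen_douglas_A[OF last_lt] X.open_\<Omega> Y.nonvanishing z]
          laplace_ln_norm[OF d(1) X.open_\<Omega> z d(3)] laplace_ln_norm[OF d'(1) X.open_\<Omega> z d'(3)]
        by simp
    qed
  qed (use d(3) d'(3) r(2) in blast)+
  have norm_eq: "norm (t i z) = norm (\<phi> z *\<^sub>C t' i z)" if "i < n" "z \<in> ball w\<^sub>0 r" for i z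
    using norm_t_eq[OF ratio _ \<phi>(3) _ that(1)] that(2) r(2) \<phi>(2) by auto
  define v where "v = (\<lambda>(i, z). t i z)"
  \<comment> \<open>The same \<phi> multiplies all the sections, so the recursion, and with it the
    action of the superdiagonal part, is preserved.\<close>
  define v' where "v' = (\<lambda>(i, z). \<phi> z *\<^sub>C t' i z)"
  let ?I = "{..<n} \<times> D"
  have t_hol: "t i vholomorphic_on ball w\<^sub>0 r" "(\<lambda>z. \<phi> z *\<^sub>C t' i z) vholomorphic_on ball w\<^sub>0 r"
    if "i < n" for i
    using vholomorphic_on_subset[OF X.t_vholomorphic[OF that] r(2)]
      vholomorphic_on_scaleC(1)[OF \<phi>(1) vholomorphic_on_subset[OF Y.t_vholomorphic[OF that] r(2)] open_ball] .
  have gram: "\<forall>p\<in>?I. \<forall>q\<in>?I. cinner (v p) (v q) = cinner (v' p) (v' q)"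
  proof (intro ballI)
    fix p q assume "p \<in> ?I" "q \<in> ?I"
    then obtain i z j y where pq: "p = (i, z)" "q = (j, y)" "i < n" "j < n" "z \<in> D" "y \<in> D"
      by auto
    then have \<Omega>: "z \<in> \<Omega>" "y \<in> \<Omega>"
      using D(3) by auto
    show "cinner (v p) (v q) = cinner (v' p) (v' q)"
    proof (cases "i = j")
      case True
      then show ?thesis
        using cinner_eq_if_norm_eq[OF t_hol[OF pq(3)] norm_eq[OF pq(3)], of z y] pq
        by (simp add: v_def v'_def D_def)
    next
      case False
      then show ?thesis
        using X.cinner_H[OF pq(3,4) False X.t_in X.t_in] Y.cinner_H[OF pq(3,4) False Y.t_in Y.t_in] pq \<Omega>
        by (simp add: v_def v'_def cinner_scaleC_left cinner_scaleC_right)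
    qed
  qed
  have total: "closure (cspan (v ` ?I)) = UNIV" "closure (cspan (v' ` ?I)) = UNIV"
  proof -
    show "closure (cspan (v ` ?I)) = UNIV"
    proof (rule closure_cspan_eq_UNIV)
      fix x assume *: "\<And>u. u \<in> v ` ?I \<Longrightarrow> cinner u x = 0"
      show "x = 0"
        by (rule X.eq_0_if_cinner_t[OF D]) (use * in \<open>force simp: v_def\<close>)
    qed
    show "closure (cspan (v' ` ?I)) = UNIV"
    proof (rule closure_cspan_eq_UNIV)
      fix x assume *: "\<And>u. u \<in> v' ` ?I \<Longrightarrow> cinner u x = 0"
      show "x = 0"
      proof (rule Y.eq_0_if_cinner_t[OF D])
        fix i z assume "i < n" "z \<in> D"
        then have "cinner (v' (i, z)) x = 0"
          by (intro * imageI) simp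
        then show "cinner (t' i z) x = 0"
          using \<phi>(2) by (simp add: v'_def cinner_scaleC_left)
      qed
    qed
  qed
  obtain U where U: "unitary U" "\<And>p. p \<in> ?I \<Longrightarrow> U (v p) = v' p"
    using unitary_if_gram_eq[OF gram total] by blast
  have Ub: "bounded_operator UNIV UNIV U"
    using U(1) by (simp add: unitary_def)
  note U_simps = bounded_operatorD(2,3)[OF Ub UNIV_I]
  interpret U: bounded_linear U
    by (rule bounded_operator_UNIV_imp_bounded_linear[OF Ub])
  have Ut: "U (t i z) = \<phi> z *\<^sub>C t' i z" if "i < n" "z \<in> D" for i z
    using U(2)[of "(i, z)"] that by (simp add: v_def v'_def)
  have US: "U (X.S (t i z)) = Y.S (U (t i z))" if "i < n" "z \<in> D" for i z
  proof -
    have z: "z \<in> \<Omega>"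
      using that D(3) by blast
    show ?thesis
    proof (cases i)
      case 0
      then show ?thesis
        using that z by (simp add: X.S_t_0 Ut Y.S_simps Y.S_t_0 U.zero)
    next
      case (Suc k)
      then show ?thesis
        using that z by (simp add: X.S_t Ut Y.S_simps Y.S_t)
    qed
  qed
  have "U (T x) - T' (U x) = 0" for x
  proof -
    \<comment> \<open>A closed subspace containing the total family \<open>v\<close>; hence the
      intertwining relation need only be checked on the vectors \<open>t i z\<close>.\<close>
    let ?N = "(\<lambda>x. U (T x) - T' (U x)) -` {0}"
    have N: "closed_csubspace ?N"
      by (intro closed_csubspace_vimage Y.closed_csubspace_singleton_0 bounded_operator_diff
          bounded_operator_compose[OF Ub X.bounded_operator_T] bounded_operator_compose[OF Y.bounded_operator_T Ub])
    have "v ` ?I \<subseteq> ?N"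
    proof
      fix u assume "u \<in> v ` ?I"
      then obtain i z where iz: "u = t i z" "i < n" "z \<in> D"
        by (auto simp: v_def)
      then have z: "z \<in> \<Omega>"
        using D(3) by blast
      have "U (T u) = z *\<^sub>C U u + Y.S (U u)"
        using X.T_t[OF iz(2) z] US[OF iz(2,3)] by (simp add: iz(1) U_simps)
      also have "\<dots> = T' (U u)"
        using Y.T_t[OF iz(2) z]
        by (simp add: iz(1) Ut[OF iz(2,3)] Y.S_simps Y.T_simps scaleC_add_right scaleC_scaleC mult.commute)
      finally show "u \<in> ?N"
        by simp
    qed
    then have "closure (cspan (v ` ?I)) \<subseteq> ?N"
      using N by (intro closure_minimal complex_vector.span_minimal) (auto simp: closed_csubspace_def)
    then show ?thesis
      using total(1) by blast
  qed
  then show ?thesis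
    unfolding unitarily_equivalent_def using U(1) by auto
qed

end

section \<open>Necessity: a unitary intertwiner respects the blocks\<close>

locale unitary_intertwiner = flag_operators \<Omega> n H H' T T' A A' t t'
  for \<Omega> :: "complex set" and n :: nat
    and H :: "nat \<Rightarrow> 'a::chilbert_space set" and H' :: "nat \<Rightarrow> 'b::chilbert_space set"
    and T :: "'a \<Rightarrow> 'a" and T' :: "'b \<Rightarrow> 'b"
    and A :: "nat \<Rightarrow> nat \<Rightarrow> 'a \<Rightarrow> 'a" and A' :: "nat \<Rightarrow> nat \<Rightarrow> 'b \<Rightarrow> 'b"
    and t :: "nat \<Rightarrow> complex \<Rightarrow> 'a" and t' :: "nat \<Rightarrow> complex \<Rightarrow> 'b" +
  fixes U :: "'a \<Rightarrow> 'b"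
  assumes unitary_U: "unitary U" and U_T: "U (T x) = T' (U x)"
begin

lemma bounded_operator_U: "bounded_operator UNIV UNIV U"
  using unitary_U by (simp add: unitary_def)

lemmas U_simps = bounded_operatorD(2,3)[OF bounded_operator_U UNIV_I]

sublocale U: bounded_linear U
  by (rule bounded_operator_UNIV_imp_bounded_linear[OF bounded_operator_U])

lemma cinner_U: "cinner (U x) (U y) = cinner x y"
  using unitary_U by (simp add: unitary_def)

lemma norm_U: "norm (U x) = norm x"
  by (intro norm_eq_if_cinner_eq cinner_U)

lemma U_eq_0_iff: "U x = 0 \<longleftrightarrow> x = 0"
  using norm_U[of x] by (metis norm_eq_zero)

text \<open>The composite \<open>S ^^ m \<circ> V \<circ> S' ^^ k \<circ> U\<close> commutes with \<open>T\<close>, has \<open>\<gamma>\<close> as an eigenvector modulo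
  \<open>F j\<close>, and for \<open>k > 0\<close> it is a commutator with \<open>T\<close>. Hence \<open>k = 0\<close>.\<close>

lemma U_t_mod_F:
  assumes FF: "\<And>x. x \<in> X.F j \<longleftrightarrow> U x \<in> Y.F j" and j: "j < n" and w: "w \<in> \<Omega>"
    and nz: "t 0 w \<noteq> 0" "t' 0 w \<noteq> 0"
  obtains a where "a \<noteq> 0" and "U (t j w) - a *\<^sub>C t' j w \<in> Y.F j"
proof -
  obtain V where V: "bounded_operator UNIV UNIV V" "\<And>y. U (V y) = y" "\<And>x. V (U x) = x"
    using unitary_inverse[OF unitary_U] by blast
  note V_simps = bounded_operatorD(2,3)[OF V(1) UNIV_I]
  have VF: "V y \<in> X.F j" if "y \<in> Y.F j" for y
    using FF[of "V y"] that by (simp add: V)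
  have VT: "V (T' y) = T (V y)" for y
    by (metis U_T V(2,3))
  obtain \<gamma> where \<gamma>: "T \<gamma> = w *\<^sub>C \<gamma>" "\<gamma> - t j w \<in> X.F j"
    using X.eigenvector_over_t[OF w j] by blast
  obtain \<gamma>' where \<gamma>': "T' \<gamma>' = w *\<^sub>C \<gamma>'" "\<gamma>' - t' j w \<in> Y.F j"
    using Y.eigenvector_over_t[OF w j] by blast
  have "t j w \<notin> X.F j" "t' j w \<notin> Y.F j"
    using X.t_notin_F X.t_nonzero_mono Y.t_notin_F Y.t_nonzero_mono nz j w by (meson le0)+
  then have \<gamma>F: "\<gamma> \<notin> X.F j" and \<gamma>'F: "\<gamma>' \<notin> Y.F j"
    using X.F_closed(4)[of \<gamma> j "\<gamma> - t j w"] Y.F_closed(4)[of \<gamma>' j "\<gamma>' - t' j w"] \<gamma>(2) \<gamma>'(2) by auto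
  \<comment> \<open>\<open>U \<gamma>\<close> is an eigenvector of T' outside \<open>Y.F j\<close>,
    but its top component may have an index above j. The number k measures this excess.\<close>
  obtain k a where a: "a \<noteq> 0" "(Y.S ^^ k) (U \<gamma>) - a *\<^sub>C t' j w \<in> Y.F j"
    using Y.eigenvector_lowered[OF w nz(2) _ _ j, of "U \<gamma>"] \<gamma>F FF \<gamma>(1) by (metis U_T U_simps(2))
  have a': "(Y.S ^^ k) (U \<gamma>) - a *\<^sub>C \<gamma>' \<in> Y.F j"
  proof -
    have "(Y.S ^^ k) (U \<gamma>) - a *\<^sub>C \<gamma>' = ((Y.S ^^ k) (U \<gamma>) - a *\<^sub>C t' j w) - a *\<^sub>C (\<gamma>' - t' j w)"
      by (simp add: complex_vector.scale_right_diff_distrib)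
    then show ?thesis
      using a(2) \<gamma>'(2) Y.F_closed(3,4) by metis
  qed
  have "V \<gamma>' \<notin> X.F j"
    using FF[of "V \<gamma>'"] \<gamma>'F by (simp add: V)
  then obtain m b where b: "b \<noteq> 0" "(X.S ^^ m) (V \<gamma>') - b *\<^sub>C t j w \<in> X.F j"
    using X.eigenvector_lowered[OF w nz(1) _ _ j, of "V \<gamma>'"] \<gamma>'(1) VT V_simps(2) by metis
  have b': "(X.S ^^ m) (V \<gamma>') - b *\<^sub>C \<gamma> \<in> X.F j"
  proof -
    have "(X.S ^^ m) (V \<gamma>') - b *\<^sub>C \<gamma> = ((X.S ^^ m) (V \<gamma>') - b *\<^sub>C t j w) - b *\<^sub>C (\<gamma> - t j w)"
      by (simp add: complex_vector.scale_right_diff_distrib)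
    then show ?thesis
      using b(2) \<gamma>(2) X.F_closed(3,4) by metis
  qed
  have "k = 0"
  proof (rule ccontr)
    assume "k \<noteq> 0"
    then obtain l where l: "k = Suc l"
      by (cases k) auto
    define B where "B x = T x - w *\<^sub>C x" for x
    \<comment> \<open>One factor \<open>Y.S\<close> is split off from its k-th power, which is
      possible as k > 0. Since [T', \<open>Y.G\<close>] = \<open>Y.S\<close> and \<open>Z\<close>,
      \<open>U\<close> intertwine, putting \<open>Y.G\<close> in its place gives \<open>C\<close>
      with [B, C] = \<open>Y\<^sub>0\<close>.\<close>
    define Z where "Z y = (X.S ^^ m) (V ((Y.S ^^ l) y))" for y
    define C where "C x = Z (Y.G (U x))" for x
    define Y\<^sub>0 where "Y\<^sub>0 x = Z (Y.S (U x))" for x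
    have Zb: "bounded_operator UNIV UNIV Z"
      unfolding Z_def[abs_def]
      by (intro bounded_operator_compose[OF bounded_operator_funpow[OF X.bounded_operator_S]]
          bounded_operator_compose[OF V(1)] bounded_operator_funpow Y.bounded_operator_S)
    note Z_simps = bounded_operatorD(2,3)[OF Zb UNIV_I]
    interpret Z: bounded_linear Z
      by (rule bounded_operator_UNIV_imp_bounded_linear[OF Zb])
    have ZT: "T (Z y) = Z (T' y)" for y
      by (simp add: Z_def X.T_S_funpow Y.T_S_funpow flip: VT)
    have "\<gamma> \<in> X.F j"
    proof (rule commutator_no_eigenvalue)
      show "bounded_operator UNIV UNIV B"
        unfolding B_def[abs_def]
        by (intro bounded_operator_diff X.bounded_operator_T bounded_operator_scaleC bounded_operator_id)
      show "bounded_operator UNIV UNIV C"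
        unfolding C_def[abs_def]
        by (intro bounded_operator_compose[OF Zb] bounded_operator_compose[OF Y.bounded_operator_G bounded_operator_U])
      show "B (C x) = C (B x) + Y\<^sub>0 x" for x
      proof -
        have "Y.G (U (B x)) = Y.G (T' (U x)) - w *\<^sub>C Y.G (U x)"
          using linear_diff[OF bounded_linear.linear[OF bounded_operator_UNIV_imp_bounded_linear[OF Y.bounded_operator_G]]]
          by (simp add: B_def U.diff U_simps Y.G_simps U_T)
        then show ?thesis
          by (simp add: C_def Y\<^sub>0_def B_def ZT Y.S_def Z.diff Z_simps)
      qed
      show "B (Y\<^sub>0 x) = Y\<^sub>0 (B x)" for x
        by (simp add: Y\<^sub>0_def B_def ZT Y.T_S U.diff U_T Y.S.diff Z.diff Z_simps U_simps Y.S_simps)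
      show "B \<gamma> = 0"
        by (simp add: B_def \<gamma>(1))
      show "closed_csubspace (X.F j)"
        by (rule X.closed_csubspace_F)
      have Y\<^sub>0_eq: "Y\<^sub>0 x = (X.S ^^ m) (V ((Y.S ^^ k) (U x)))" for x
        by (simp add: Y\<^sub>0_def Z_def l funpow_swap1)
      show "Y\<^sub>0 x \<in> X.F j" if "x \<in> X.F j" for x
        unfolding Y\<^sub>0_eq using that j FF
        by (intro X.S_funpow_F_subset VF Y.S_funpow_F_subset) auto
      show "Y\<^sub>0 \<gamma> - (a * b) *\<^sub>C \<gamma> \<in> X.F j"
      proof -
        \<comment> \<open>The round trip multiplies \<gamma> by a on the way out and by b on the way
          back; the errors, f' among them, end up in \<open>X.F j\<close>.\<close>
        define f' where "f' = (Y.S ^^ k) (U \<gamma>) - a *\<^sub>C \<gamma>'"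
        note Sm = bounded_operatorD(2,3)[OF bounded_operator_funpow[OF X.bounded_operator_S] UNIV_I]
        have "(Y.S ^^ k) (U \<gamma>) = a *\<^sub>C \<gamma>' + f'"
          by (simp add: f'_def)
        then have "Y\<^sub>0 \<gamma> = a *\<^sub>C (X.S ^^ m) (V \<gamma>') + (X.S ^^ m) (V f')"
          unfolding Y\<^sub>0_eq by (simp add: V_simps Sm)
        then have "Y\<^sub>0 \<gamma> - (a * b) *\<^sub>C \<gamma> = a *\<^sub>C ((X.S ^^ m) (V \<gamma>') - b *\<^sub>C \<gamma>) + (X.S ^^ m) (V f')"
          by (simp add: complex_vector.scale_right_diff_distrib scaleC_scaleC)
        moreover have "(X.S ^^ m) (V f') \<in> X.F j"
          using a' j by (intro X.S_funpow_F_subset VF) (auto simp: f'_def)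
        ultimately show ?thesis
          using b' X.F_closed(2,3) by metis
      qed
      show "a * b \<noteq> 0"
        using a b by simp
    qed
    then show False
      using \<gamma>F by blast
  qed
  then have "U \<gamma> - a *\<^sub>C t' j w \<in> Y.F j"
    using a(2) by simp
  moreover have "U (\<gamma> - t j w) \<in> Y.F j"
    using FF \<gamma>(2) by blast
  moreover have "U (t j w) - a *\<^sub>C t' j w = (U \<gamma> - a *\<^sub>C t' j w) - U (\<gamma> - t j w)"
    by (simp add: U.diff)
  ultimately have "U (t j w) - a *\<^sub>C t' j w \<in> Y.F j"
    using Y.F_closed(4) by metis
  then show ?thesis
    using that a(1) by blast
qed

text \<open>The step compares \<open>U (t j w)\<close> with \<open>t' j w\<close> modulo
  \<open>Y.F j\<close> by \<open>U_t_mod_F\<close>. As the factor a is non-zero, the comparison can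
  be inverted, which yields both implications; totality extends them to the whole summands.\<close>

lemma U_F: "j \<le> n \<Longrightarrow> x \<in> X.F j \<longleftrightarrow> U x \<in> Y.F j"
proof (induction j arbitrary: x)
  case 0
  then show ?case
    by (simp add: X.F_0 Y.F_0 U_eq_0_iff)
next
  case (Suc j)
  then have j: "j < n" and IH: "\<And>x. x \<in> X.F j \<longleftrightarrow> U x \<in> Y.F j"
    by auto
  obtain V where V: "bounded_operator UNIV UNIV V" "\<And>y. U (V y) = y" "\<And>x. V (U x) = x"
    using unitary_inverse[OF unitary_U] by blast
  note V_simps = bounded_operatorD(2,3)[OF V(1) UNIV_I]
  have VF: "V y \<in> X.F j" if "y \<in> Y.F j" for y
    using IH[of "V y"] that by (simp add: V)
  have F_mono: "X.F j \<subseteq> X.F (Suc j)" "Y.F j \<subseteq> Y.F (Suc j)"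
    using X.F_mono Y.F_mono by simp_all
  \<comment> \<open>The points at which both lowest sections, hence all sections, are non-zero. Were
    this set empty, \<open>t' 0\<close> would vanish on the non-empty open set
    \<open>D\<^sub>1\<close>, which by totality forces \<open>H' 0\<close> to be zero.\<close>
  define D\<^sub>1 where "D\<^sub>1 = {w \<in> \<Omega>. t 0 w \<noteq> 0}"
  define D where "D = {w \<in> D\<^sub>1. t' 0 w \<noteq> 0}"
  have n0: "0 < n"
    using X.n_ge_2 by simp
  have D\<^sub>1: "open D\<^sub>1" "D\<^sub>1 \<noteq> {}" "D\<^sub>1 \<subseteq> \<Omega>"
    using continuous_open_preimage[OF vholomorphic_on_imp_continuous_on[OF X.t_vholomorphic[OF n0]] X.open_\<Omega>, of "- {0}"]
      X.t_not_identically_0[OF n0] by (auto simp: D\<^sub>1_def vimage_def Int_def)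
  have D: "open D" "D \<noteq> {}" "D \<subseteq> \<Omega>"
  proof -
    show "open D"
      using continuous_open_preimage[OF continuous_on_subset[OF vholomorphic_on_imp_continuous_on[OF Y.t_vholomorphic[OF n0]] D\<^sub>1(3)] D\<^sub>1(1), of "- {0}"]
      by (auto simp: D_def vimage_def Int_def)
    show "D \<noteq> {}"
    proof
      assume "D = {}"
      then have "H' 0 \<subseteq> {0}"
        by (intro Y.t_total[OF n0 D\<^sub>1 Y.closed_csubspace_singleton_0]) (auto simp: D_def)
      then show False
        using Y.t_not_identically_0[OF n0] Y.t_in[OF n0] by blast
    qed
    show "D \<subseteq> \<Omega>"
      using D\<^sub>1(3) by (auto simp: D_def)
  qed
  have *: "U (t j w) \<in> Y.F (Suc j) \<and> V (t' j w) \<in> X.F (Suc j)" if "w \<in> D" for w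
  proof -
    have w: "w \<in> \<Omega>" "t 0 w \<noteq> 0" "t' 0 w \<noteq> 0"
      using that by (auto simp: D_def D\<^sub>1_def)
    obtain a where a: "a \<noteq> 0" "U (t j w) - a *\<^sub>C t' j w \<in> Y.F j"
      using U_t_mod_F[OF IH j w] by blast
    have tF: "t j w \<in> X.F (Suc j)" "t' j w \<in> Y.F (Suc j)"
      using X.H_subset_F[OF X.t_in[OF j w(1)]] Y.H_subset_F[OF Y.t_in[OF j w(1)]] j by auto
    have "U (t j w) = (U (t j w) - a *\<^sub>C t' j w) + a *\<^sub>C t' j w"
      by simp
    then have "U (t j w) \<in> Y.F (Suc j)"
      using a(2) F_mono(2) tF(2) Y.F_closed(2,3) by (metis subsetD)
    moreover have "V (t' j w) = (1 / a) *\<^sub>C (t j w - V (U (t j w) - a *\<^sub>C t' j w))"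
      using a(1) linear_diff[OF bounded_linear.linear[OF bounded_operator_UNIV_imp_bounded_linear[OF V(1)]]]
      by (simp add: V V_simps scaleC_scaleC)
    then have "V (t' j w) \<in> X.F (Suc j)"
      using VF[OF a(2)] F_mono(1) tF(1) X.F_closed(3,4) by (metis subsetD)
    ultimately show ?thesis
      by blast
  qed
  have H_sub: "H j \<subseteq> U -` Y.F (Suc j)"
    using * by (intro X.t_total[OF j D] closed_csubspace_vimage bounded_operator_U Y.closed_csubspace_F) auto
  have H'_sub: "H' j \<subseteq> V -` X.F (Suc j)"
    using * by (intro Y.t_total[OF j D] closed_csubspace_vimage V(1) X.closed_csubspace_F) auto
  show ?case
  proof
    assume x: "x \<in> X.F (Suc j)"
    have "U (x - X.P j x) \<in> Y.F (Suc j)"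
      using IH X.F_diff_P[OF x j] F_mono(2) by blast
    moreover have "U (X.P j x) \<in> Y.F (Suc j)"
      using H_sub X.P_in[OF j] by blast
    ultimately have "U (x - X.P j x) + U (X.P j x) \<in> Y.F (Suc j)"
      by (rule Y.F_closed)
    then show "U x \<in> Y.F (Suc j)"
      by (simp add: U.diff)
  next
    assume x: "U x \<in> Y.F (Suc j)"
    have "V (U x - Y.P j (U x)) \<in> X.F (Suc j)"
      using VF[OF Y.F_diff_P[OF x j]] F_mono(1) by blast
    moreover have "V (Y.P j (U x)) \<in> X.F (Suc j)"
      using H'_sub Y.P_in[OF j] by blast
    ultimately have "V (U x - Y.P j (U x)) + V (Y.P j (U x)) \<in> X.F (Suc j)"
      by (rule X.F_closed)
    then show "x \<in> X.F (Suc j)"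
      by (simp add: V flip: V_simps(1))
  qed
qed

text \<open>\<open>U\<close> matches the flags and preserves orthogonality, so it matches the
  orthogonal differences of consecutive members.\<close>

lemma U_H:
  assumes j: "j < n" and x: "x \<in> H j" shows "U x \<in> H' j"
proof (rule Y.mem_HI[OF _ _ j])
  show "U x \<in> Y.F (Suc j)"
    using U_F[of "Suc j" x] X.H_subset_F[OF x, of "Suc j"] j by simp
  fix y assume y: "y \<in> Y.F j"
  obtain z where z: "y = U z"
    using unitary_U unfolding unitary_def surj_def by blast
  then have "z \<in> X.F j"
    using U_F[of j z] y j by simp
  then show "cinner (U x) y = 0"
    using X.cinner_F_H[OF _ x j, of z] cinner_eq_zero_commute[of z x] by (simp add: z cinner_U)
qed

text \<open>As \<open>U\<close> maps summands to summands of the same index, it intertwines the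
  gradings \<open>G\<close>, and \<open>S\<close> is the commutator of \<open>T\<close> with
  \<open>G\<close>.\<close>

lemma U_S: "U (X.S x) = Y.S (U x)"
proof -
  have "U (X.G x) = Y.G (U x)" for x
  proof -
    have "U (X.G (\<Sum>i<n. X.P i x)) = Y.G (U (\<Sum>i<n. X.P i x))"
      unfolding U.sum linear_sum[OF bounded_linear.linear[OF bounded_operator_UNIV_imp_bounded_linear[OF X.bounded_operator_G]]]
        linear_sum[OF bounded_linear.linear[OF bounded_operator_UNIV_imp_bounded_linear[OF Y.bounded_operator_G]]]
      using X.P_in U_H by (intro sum.cong) (auto simp: X.G_H Y.G_H U_simps)
    then show ?thesis
      by (simp add: X.sum_P)
  qed
  then show ?thesis
    by (simp add: X.S_def Y.S_def U.diff U_T)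
qed

text \<open>The image of \<open>t (n - 1)\<close> under \<open>U\<close> is a non-vanishing section
  for the other operator with the same norm, so it computes the other curvature.\<close>

lemma curvatures_and_ratios_eq: "curvatures_eq \<and> ratios_eq"
proof
  let ?u = "\<lambda>w. U (t (n - 1) w)"
  have A'U: "A' (n - 1) (n - 1) (?u w) = w *\<^sub>C ?u w" "?u w \<in> H' (n - 1)" if w: "w \<in> \<Omega>" for w
  proof -
    show in_H': "?u w \<in> H' (n - 1)"
      by (rule U_H[OF last_lt X.t_in[OF last_lt w]])
    have "A' (n - 1) (n - 1) (?u w) = T' (?u w) - Y.S (?u w)"
      using Y.T_H_S[OF last_lt in_H'] by simp
    also have "\<dots> = U (T (t (n - 1) w) - X.S (t (n - 1) w))"
      by (simp add: U.diff U_T U_S)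
    also have "\<dots> = w *\<^sub>C ?u w"
      using X.T_t[OF last_lt w] by (simp add: U_simps)
    finally show "A' (n - 1) (n - 1) (?u w) = w *\<^sub>C ?u w" .
  qed
  note d = nonvanishing_sectionD[OF X.nonvanishing]
  have u: "nonvanishing_section \<Omega> (H' (n - 1)) (A' (n - 1) (n - 1)) ?u"
    using vholomorphic_on_bounded_operator[OF bounded_operator_U d(1)] A'U d(3)
    unfolding nonvanishing_section_def holomorphic_section_def vholomorphic_on_def eigenspace_def
    by (simp add: U_eq_0_iff)
  show curvatures_eq
    using curvature_eq[OF X.cowen_douglas_A[OF last_lt] X.open_\<Omega> X.nonvanishing]
      curvature_eq[OF Y.cowen_douglas_A[OF last_lt] X.open_\<Omega> u]
    by (simp add: norm_U)
  show ratios_eq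
  proof (intro ballI impI)
    fix i w assume i: "i \<in> {1..n - 1}" and w: "w \<in> \<Omega>" and nz: "t i w \<noteq> 0 \<and> t' i w \<noteq> 0"
    \<comment> \<open>The scalar c at the top level is inherited by all lower levels through
      \<open>U_S\<close>, so it cancels from the ratios.\<close>
    obtain c where c: "?u w = c *\<^sub>C t' (n - 1) w"
      using eigenspace_multiple[OF Y.cowen_douglas_A[OF last_lt] w
          nonvanishing_sectionD(2)[OF Y.nonvanishing w] nonvanishing_sectionD(3)[OF Y.nonvanishing w]
          nonvanishing_sectionD(2)[OF u w]] by blast
    have "U (t k w) = c *\<^sub>C t' k w" if "k \<le> n - 1" for k
      using that
    proof (induction k rule: inc_induct)
      case base
      show ?case
        by (rule c)
    next
      case (step k)
      then have k: "Suc k < n"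
        by auto
      have "U (t k w) = Y.S (U (t (Suc k) w))"
        using X.S_t[OF k w] U_S by metis
      then show ?case
        using Y.S_t[OF k w] by (simp add: step.IH Y.S_simps)
    qed
    then have norm_t: "norm (t k w) = cmod c * norm (t' k w)" if "k \<le> n - 1" for k
      using that norm_U[of "t k w"] by simp
    have "cmod c \<noteq> 0"
      using norm_t[of i] i nz by auto
    then show "norm (t (i - 1) w) / norm (t i w) = norm (t' (i - 1) w) / norm (t' i w)"
      using norm_t[of i] norm_t[of "i - 1"] i by auto
  qed
qed

end

theorem theorem3p11:
  fixes \<Omega> :: "complex set" and n :: nat
    and H :: "nat \<Rightarrow> 'a::chilbert_space set" and H' :: "nat \<Rightarrow> 'b::chilbert_space set"
    and T :: "'a \<Rightarrow> 'a" and T' :: "'b \<Rightarrow> 'b"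
    and A :: "nat \<Rightarrow> nat \<Rightarrow> 'a \<Rightarrow> 'a" and A' :: "nat \<Rightarrow> nat \<Rightarrow> 'b \<Rightarrow> 'b"
    and t :: "nat \<Rightarrow> complex \<Rightarrow> 'a" and t' :: "nat \<Rightarrow> complex \<Rightarrow> 'b"
  assumes "open \<Omega>" and "connected \<Omega>" and "2 \<le> n"
    and "FB_tilde n \<Omega> H T A" and "FB_tilde n \<Omega> H' T' A'"
    and "nonvanishing_section \<Omega> (H (n - 1)) (A (n - 1) (n - 1)) (t (n - 1))"
    and "nonvanishing_section \<Omega> (H' (n - 1)) (A' (n - 1) (n - 1)) (t' (n - 1))"
    and "\<forall>i\<in>{1..n - 1}. \<forall>w\<in>\<Omega>. t (i - 1) w = A (i - 1) i (t i w)"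
    and "\<forall>i\<in>{1..n - 1}. \<forall>w\<in>\<Omega>. t' (i - 1) w = A' (i - 1) i (t' i w)"
  shows "unitarily_equivalent T T' \<longleftrightarrow>
     (\<forall>w\<in>\<Omega>. curvature \<Omega> (H (n - 1)) (A (n - 1) (n - 1)) w
            = curvature \<Omega> (H' (n - 1)) (A' (n - 1) (n - 1)) w) \<and>
     (\<forall>i\<in>{1..n - 1}. \<forall>w\<in>\<Omega>. t i w \<noteq> 0 \<and> t' i w \<noteq> 0 \<longrightarrow>
        norm (t (i - 1) w) / norm (t i w) = norm (t' (i - 1) w) / norm (t' i w))"
proof -
  interpret flag_operators \<Omega> n H H' T T' A A' t t'
    by unfold_locales (fact assms)+
  show ?thesis
  proof
    assume "unitarily_equivalent T T'"
    then obtain U where "unitary U" "\<And>x. U (T x) = T' (U x)"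
      unfolding unitarily_equivalent_def by blast
    then interpret unitary_intertwiner \<Omega> n H H' T T' A A' t t' U
      by unfold_locales
    show "curvatures_eq \<and> ratios_eq"
      by (rule curvatures_and_ratios_eq)
  qed (use unitarily_equivalent_if in blast)
qed

end
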